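(* Let $F\in \mathrm{TA}_n(\mathbb{F}_q(Z))\cap \mathrm{GA}_n(\mathbb{F}_q[Z])$, and suppose that $F_c\in \mathrm{TA}_n(\mathbb{F}_q[c])$ for all $c\in\mathbb{F}_{q^m}$ (for all $m$). Then $F\in \mathrm{PTA}_n(\mathbb{F}_q[Z])$; concretely, for every $m\in\mathbb{N}$ there exists $G_m\in \mathrm{TA}_n(\mathbb{F}_q[Z])$ such that $\pi_{q^m}(G_m)=\pi_{q^m}(F)$ as maps on $\mathbb{F}_{q^m}^{n+1}$.
   Context: For a ring $R$, $\mathrm{MA}_n(R)$ denotes the polynomial maps $R[X_1,\dots,X_n]^n$ under composition, $\mathrm{GA}_n(R)$ its invertible elements (polynomial automorphisms). For a field $k$, $\mathrm{TA}_n(k)$ is the tame automorphism group, i.e. the subgroup of $\mathrm{GA}_n(k)$ generated by the invertible affine maps and the triangular (Jonquières) maps $(a_1X_1+f_1,\dots,a_nX_n+f_n)$ with $a_i\in k^*$, $f_i\in k[X_{i+1},\dots,X_n]$; the same definition is used over $\mathbb{F}_q[Z]$. For $F\in \mathrm{GA}_n(k[Z])$ and $c\in k$ (or in an extension), $F_c$ denotes the specialization $Z=c$. A map $F\in\mathrm{GA}_n(\mathbb{F}_q[Z])$ is identified with $(F,Z)\in\mathrm{GA}_{n+1}(\mathbb{F}_q)$. For $F\in\mathrm{MA}_N(\mathbb{F}_q)$, $\pi_{q^m}(F)$ is the induced map $\mathbb{F}_{q^m}^N\to\mathbb{F}_{q^m}^N$. The profinite tame group $\mathrm{PTA}_N(\mathbb{F}_q)$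 is the inverse limit over $m$ of the groups $\pi_{q^m}(\mathrm{TA}_N(\mathbb{F}_q))$ (under the restriction maps for $d\mid m$), and $\mathrm{PTA}_n(\mathbb{F}_q[Z])\subseteq \mathrm{PTA}_{n+1}(\mathbb{F}_q)$ is defined analogously using $\mathrm{TA}_n(\mathbb{F}_q[Z])$. *)

theory Defs
  imports "HOL-Library.Poly_Mapping" "HOL-Computational_Algebra.Polynomial"
    "HOL-Computational_Algebra.Fraction_Field"
begin

type_synonym 'k mpoly = "(nat \<Rightarrow>\<^sub>0 nat) \<Rightarrow>\<^sub>0 'k"

text \<open>A polynomial map in n variables: components 0..n-1, all others 0.\<close>
type_synonym 'k pmap = "nat \<Rightarrow> 'k mpoly"

definition mConst :: "'k::comm_ring_1 \<Rightarrow> 'k mpoly" where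
  "mConst c = Poly_Mapping.single 0 c"

definition mVar :: "nat \<Rightarrow> 'k::comm_ring_1 mpoly" where
  "mVar i = Poly_Mapping.single (Poly_Mapping.single i 1) 1"

definition subst :: "'k::comm_ring_1 mpoly \<Rightarrow> 'k pmap \<Rightarrow> 'k mpoly" where
  "subst p G = (\<Sum>a::nat \<Rightarrow>\<^sub>0 nat\<in>Poly_Mapping.keys p. mConst (Poly_Mapping.lookup p a) * (\<Prod>j\<in>Poly_Mapping.keys a. G j ^ Poly_Mapping.lookup a j))"

definition evalp :: "'k::comm_ring_1 mpoly \<Rightarrow> (nat \<Rightarrow> 'k) \<Rightarrow> 'k" where
  "evalp p x = (\<Sum>a::nat \<Rightarrow>\<^sub>0 nat\<in>Poly_Mapping.keys p. Poly_Mapping.lookup p a * (\<Prod>j\<in>Poly_Mapping.keys a. x j ^ Poly_Mapping.lookup a j))"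

definition coeffs_in :: "'k::comm_ring_1 set \<Rightarrow> 'k mpoly \<Rightarrow> bool" where
  "coeffs_in S p \<longleftrightarrow> (\<forall>a\<in>Poly_Mapping.keys p. Poly_Mapping.lookup p a \<in> S)"

definition vars_in :: "nat set \<Rightarrow> 'k::comm_ring_1 mpoly \<Rightarrow> bool" where
  "vars_in V p \<longleftrightarrow> (\<forall>a\<in>Poly_Mapping.keys p. Poly_Mapping.keys a \<subseteq> V)"

text \<open>Polynomial maps in MA_n(S), S a subring of the coefficient type.\<close>
definition is_pmap :: "nat \<Rightarrow> 'k::comm_ring_1 set \<Rightarrow> 'k pmap \<Rightarrow> bool" where
  "is_pmap n S F \<longleftrightarrow> (\<forall>i<n. coeffs_in S (F i) \<and> vars_in {..<n} (F i)) \<and> (\<forall>i\<ge>n. F i = 0)"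

definition pcomp :: "nat \<Rightarrow> 'k::comm_ring_1 pmap \<Rightarrow> 'k pmap \<Rightarrow> 'k pmap" where
  "pcomp n F G = (\<lambda>i. if i < n then subst (F i) G else 0)"

definition pid :: "nat \<Rightarrow> 'k::comm_ring_1 pmap" where
  "pid n = (\<lambda>i. if i < n then mVar i else 0)"

definition is_inverse :: "nat \<Rightarrow> 'k::comm_ring_1 set \<Rightarrow> 'k pmap \<Rightarrow> 'k pmap \<Rightarrow> bool" where
  "is_inverse n S F G \<longleftrightarrow> is_pmap n S G \<and> pcomp n F G = pid n \<and> pcomp n G F = pid n"

definition GA :: "nat \<Rightarrow> 'k::comm_ring_1 set \<Rightarrow> 'k pmap set" where
  "GA n S = {F. is_pmap n S F \<and> (\<exists>G. is_inverse n S F G)}"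

definition unit_in :: "'k::comm_ring_1 set \<Rightarrow> 'k \<Rightarrow> bool" where
  "unit_in S a \<longleftrightarrow> a \<in> S \<and> (\<exists>b\<in>S. a * b = 1)"

definition is_affine :: "nat \<Rightarrow> 'k::comm_ring_1 set \<Rightarrow> 'k pmap \<Rightarrow> bool" where
  "is_affine n S F \<longleftrightarrow> is_pmap n S F \<and>
     (\<forall>i<n. \<forall>a::nat \<Rightarrow>\<^sub>0 nat\<in>Poly_Mapping.keys (F i). (\<Sum>j\<in>Poly_Mapping.keys a. Poly_Mapping.lookup a j) \<le> 1)"

definition affine_gen :: "nat \<Rightarrow> 'k::comm_ring_1 set \<Rightarrow> 'k pmap \<Rightarrow> bool" where
  "affine_gen n S F \<longleftrightarrow> is_affine n S F \<and>
     (\<exists>G. is_affine n S G \<and> pcomp n F G = pid n \<and> pcomp n G F = pid n)"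

definition triangular_gen :: "nat \<Rightarrow> 'k::comm_ring_1 set \<Rightarrow> 'k pmap \<Rightarrow> bool" where
  "triangular_gen n S F \<longleftrightarrow> is_pmap n S F \<and>
     (\<forall>i<n. \<exists>a f. unit_in S a \<and> coeffs_in S f \<and> vars_in {i<..<n} f \<and>
                  F i = mConst a * mVar i + f)"

inductive_set TA :: "nat \<Rightarrow> 'k::comm_ring_1 set \<Rightarrow> 'k pmap set" for n S where
  aff: "affine_gen n S F \<Longrightarrow> F \<in> TA n S"
| tri: "triangular_gen n S F \<Longrightarrow> F \<in> TA n S"
| comp: "F \<in> TA n S \<Longrightarrow> G \<in> TA n S \<Longrightarrow> pcomp n F G \<in> TA n S"
| inv: "F \<in> TA n S \<Longrightarrow> is_inverse n S F G \<Longrightarrow> G \<in> TA n S"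

text \<open>Ring homomorphism (embedding of F_q into a field containing all F_(q^m)).\<close>
definition ring_hom_fun :: "('a::comm_ring_1 \<Rightarrow> 'b::comm_ring_1) \<Rightarrow> bool" where
  "ring_hom_fun \<iota> \<longleftrightarrow> \<iota> 1 = 1 \<and> (\<forall>x y. \<iota> (x + y) = \<iota> x + \<iota> y) \<and> (\<forall>x y. \<iota> (x * y) = \<iota> x * \<iota> y)"

definition spec :: "('a::comm_ring_1 \<Rightarrow> 'b::comm_ring_1) \<Rightarrow> 'b \<Rightarrow> 'a poly mpoly \<Rightarrow> 'b mpoly" where
  "spec \<iota> c p = Poly_Mapping.map (\<lambda>h. poly (map_poly \<iota> h) c) p"

definition to_frac :: "'a::idom poly mpoly \<Rightarrow> 'a poly fract mpoly" where
  "to_frac p = Poly_Mapping.map (\<lambda>h. Fract h 1) p"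

end

theory Submission
  imports Defs "Jordan_Normal_Form.Char_Poly"
begin

text \<open>Over the field \<open>S = \<iota>(\<F>\<^sub>q)[c]\<close>, Gaussian elimination writes every tame map as \<open>D\<^sub>d \<circ> E\<close>, where \<open>D\<^sub>d\<close>
  scales the last variable by \<open>d\<close> and \<open>E\<close> is a product of elementary maps \<open>x\<^sub>i \<mapsto> x\<^sub>i + f\<close>.
  The Jacobian determinant of \<open>E\<close> is 1 and that of \<open>F\<close> is a unit of \<open>\<F>\<^sub>q[Z]\<close>, so for \<open>F\<^sub>c\<close> the scalar \<open>d\<close>
  is a constant independent of \<open>c\<close>, and we may assume that all \<open>F\<^sub>c\<close> are products of elementary maps.
  Let \<open>e \<in> \<F>\<^sub>q[Z]\<close> take the value 1 at the conjugates of \<open>c\<close> and 0 at the other points of \<open>\<F>\<^bsub>q^m\<^esub>\<close>.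
  Lifting each \<open>f\<close> to \<open>\<F>\<^sub>q[Z]\<close> and multiplying it by \<open>e\<close> gives a tame map over \<open>\<F>\<^sub>q[Z]\<close> that
  specializes to \<open>F\<^sub>c\<close> at \<open>c\<close> (hence to \<open>F\<close> at all conjugates of \<open>c\<close>) and to the identity elsewhere.
  Composing these over representatives of the conjugacy classes yields \<open>G\<close>, which even has the same
  specializations as \<open>F\<close> as polynomial maps.\<close>

subsection \<open>Evaluation homomorphisms\<close>

definition mon :: "(nat \<Rightarrow> 'r::comm_ring_1) \<Rightarrow> (nat \<Rightarrow>\<^sub>0 nat) \<Rightarrow> 'r" where
  "mon x a = (\<Prod>j\<in>Poly_Mapping.keys a. x j ^ Poly_Mapping.lookup a j)"

text \<open>Evaluation along a coefficient homomorphism covers substitution, point values, dual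
  numbers and specialization at once, so additivity and multiplicativity are proved a single
  time.\<close>

definition meval :: "('k::comm_ring_1 \<Rightarrow> 'r::comm_ring_1) \<Rightarrow> (nat \<Rightarrow> 'r) \<Rightarrow> 'k mpoly \<Rightarrow> 'r" where
  "meval \<phi> x p = (\<Sum>a\<in>Poly_Mapping.keys p. \<phi> (Poly_Mapping.lookup p a) * mon x a)"

lemma mon_superset:
  assumes "finite A" "Poly_Mapping.keys a \<subseteq> A"
  shows "mon x a = (\<Prod>j\<in>A. x j ^ Poly_Mapping.lookup a j)"
  unfolding mon_def by (rule prod.mono_neutral_left) (use assms in \<open>auto simp: in_keys_iff\<close>)

lemma mon_0 [simp]: "mon x 0 = 1"
  by (simp add: mon_def)

lemma mon_add: "mon x (a + b) = mon x a * mon x b"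
proof -
  define A where "A = Poly_Mapping.keys a \<union> Poly_Mapping.keys b"
  have A: "finite A" "Poly_Mapping.keys a \<subseteq> A" "Poly_Mapping.keys b \<subseteq> A" "Poly_Mapping.keys (a + b) \<subseteq> A"
    using Poly_Mapping.keys_add[of a b] by (auto simp: A_def)
  show ?thesis
    by (simp add: A mon_superset[of A] lookup_add power_add prod.distrib)
qed

lemma mpoly_sum_single:
  "p = (\<Sum>a\<in>Poly_Mapping.keys p. Poly_Mapping.single a (Poly_Mapping.lookup p a))"
  for p :: "'k::comm_ring_1 mpoly"
proof (rule poly_mapping_eqI)
  fix k
  show "Poly_Mapping.lookup p k
    = Poly_Mapping.lookup (\<Sum>a\<in>Poly_Mapping.keys p. Poly_Mapping.single a (Poly_Mapping.lookup p a)) k"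
    by (simp add: lookup_sum lookup_single when_def in_keys_iff)
qed

lemma mpoly_single_induct [case_names zero add]:
  fixes p :: "'k::comm_ring_1 mpoly"
  assumes "P 0"
    and "\<And>a p q. a \<in> Poly_Mapping.keys p \<Longrightarrow> P q
      \<Longrightarrow> P (Poly_Mapping.single a (Poly_Mapping.lookup p a) + q)"
  shows "P p"
proof -
  have "P (\<Sum>a\<in>A. Poly_Mapping.single a (Poly_Mapping.lookup p a))"
    if "finite A" "A \<subseteq> Poly_Mapping.keys p" for A
    using that by (induction A) (auto intro: assms)
  from this[of "Poly_Mapping.keys p"] show ?thesis
    by (simp flip: mpoly_sum_single)
qed

lemma mConst_hom: "comm_ring_hom mConst"
  by unfold_locales (simp_all add: mConst_def single_add mult_single)

interpretation mConst: comm_ring_hom mConst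
  by (rule mConst_hom)

lemma mVar_power: "mVar i ^ k = Poly_Mapping.single (Poly_Mapping.single i k) 1"
  by (induction k) (simp_all add: mVar_def mult_single flip: single_add)

lemma mon_mVar: "mon mVar a = Poly_Mapping.single a (1 :: 'k::comm_ring_1)"
proof -
  have "(\<Prod>j\<in>A. mVar j ^ Poly_Mapping.lookup a j)
      = Poly_Mapping.single (\<Sum>j\<in>A. Poly_Mapping.single j (Poly_Mapping.lookup a j)) (1 :: 'k)"
    if "finite A" for A :: "nat set"
    using that by (induction A) (simp_all add: mVar_power mult_single)
  moreover have "(\<Sum>j\<in>Poly_Mapping.keys a. Poly_Mapping.single j (Poly_Mapping.lookup a j)) = a"
    by (rule poly_mapping_eqI) (simp add: lookup_sum lookup_single when_def in_keys_iff)
  ultimately show ?thesis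
    by (simp add: mon_def)
qed

lemma single_eq_mConst_mon: "Poly_Mapping.single a c = mConst c * mon mVar a"
  by (simp add: mon_mVar mConst_def mult_single)

text \<open>The polynomial is rebuilt from its own monomials: \<open>S\<close> and \<open>V\<close>
  only have to contain what occurs in \<open>p\<close>, while 0 and 1 account for the empty sum and
  the empty product.\<close>

lemma mpoly_induct_in [consumes 2, case_names zero_in one_in const var add mult]:
  fixes p :: "'k::comm_ring_1 mpoly"
  assumes "coeffs_in S p" "vars_in V p" "0 \<in> S" "1 \<in> S"
    and const: "\<And>c. c \<in> S \<Longrightarrow> P (mConst c)"
    and var: "\<And>i. i \<in> V \<Longrightarrow> P (mVar i)"
    and add: "\<And>p q. P p \<Longrightarrow> P q \<Longrightarrow> P (p + q)"
    and mult: "\<And>p q. P p \<Longrightarrow> P q \<Longrightarrow> P (p * q)"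
  shows "P p"
proof -
  have P0: "P 0" and P1: "P 1"
    using const[OF \<open>0 \<in> S\<close>] const[OF \<open>1 \<in> S\<close>] by simp_all
  have pow: "P (mVar i ^ k)" if "i \<in> V" for i k
    by (induction k) (auto intro: P1 mult var that)
  have mon: "P (mon mVar a)" if "Poly_Mapping.keys a \<subseteq> V" for a
  proof -
    have "P (\<Prod>j\<in>A. mVar j ^ Poly_Mapping.lookup a j)" if "finite A" "A \<subseteq> V" for A
      using that by (induction A) (auto intro: P1 mult pow)
    then show ?thesis using that by (simp add: mon_def)
  qed
  have "P (\<Sum>a\<in>A. Poly_Mapping.single a (Poly_Mapping.lookup p a))"
    if "finite A" "A \<subseteq> Poly_Mapping.keys p" for A
    using that
  proof (induction A)
    case (insert a A)
    then have "P (Poly_Mapping.single a (Poly_Mapping.lookup p a))"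
      using assms(1,2) unfolding single_eq_mConst_mon coeffs_in_def vars_in_def
      by (auto intro!: mult const mon)
    then show ?case using insert by (auto intro: add)
  qed (simp add: P0)
  from this[of "Poly_Mapping.keys p"] show ?thesis
    by (simp flip: mpoly_sum_single)
qed

lemma mpoly_induct [case_names const var add mult]:
  fixes p :: "'k::comm_ring_1 mpoly"
  assumes "\<And>c. P (mConst c)" "\<And>i. P (mVar i)"
    and "\<And>p q. P p \<Longrightarrow> P q \<Longrightarrow> P (p + q)" "\<And>p q. P p \<Longrightarrow> P q \<Longrightarrow> P (p * q)"
  shows "P p"
  by (rule mpoly_induct_in[of UNIV p UNIV]) (auto intro: assms simp: coeffs_in_def vars_in_def)

section \<open>Universal property of the polynomial ring\<close>

context comm_ring_hom
begin

lemma meval_superset: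
  assumes "finite A" "Poly_Mapping.keys p \<subseteq> A"
  shows "meval hom x p = (\<Sum>a\<in>A. hom (Poly_Mapping.lookup p a) * mon x a)"
  unfolding meval_def by (rule sum.mono_neutral_left) (use assms in \<open>auto simp: in_keys_iff\<close>)

lemma meval_add: "meval hom x (p + q) = meval hom x p + meval hom x q"
proof -
  define A where "A = Poly_Mapping.keys p \<union> Poly_Mapping.keys q"
  have A: "finite A" "Poly_Mapping.keys p \<subseteq> A" "Poly_Mapping.keys q \<subseteq> A" "Poly_Mapping.keys (p + q) \<subseteq> A"
    using Poly_Mapping.keys_add[of p q] by (auto simp: A_def)
  show ?thesis
    by (simp add: A meval_superset[of A] lookup_add hom_add ring_distribs sum.distrib)
qed

lemma meval_0: "meval hom x 0 = 0"
  by (simp add: meval_def)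

lemma meval_single: "meval hom x (Poly_Mapping.single a c) = hom c * mon x a"
  by (subst meval_superset[of "{a}"]) auto

lemma meval_mult: "meval hom x (p * q) = meval hom x p * meval hom x q"
proof -
  have 1: "meval hom x (Poly_Mapping.single a c * q) = meval hom x (Poly_Mapping.single a c) * meval hom x q" for a c
    by (induction q rule: mpoly_single_induct)
      (simp_all add: meval_0 meval_add ring_distribs mult_single meval_single hom_mult mon_add ac_simps)
  show ?thesis
    by (induction p rule: mpoly_single_induct) (simp_all add: meval_0 meval_add ring_distribs 1)
qed

lemma meval_mConst: "meval hom x (mConst c) = hom c"
  by (simp add: mConst_def meval_single)

lemma meval_mVar: "meval hom x (mVar i) = x i"
  by (simp add: mVar_def meval_single) (simp add: mon_def)

lemma meval_hom: "comm_ring_hom (meval hom x)"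
  using meval_mConst[of x 1]
  by unfold_locales (simp_all add: meval_add meval_mult meval_0)

end

section \<open>Substitution and point evaluation as homomorphisms\<close>

lemma subst_eq_meval: "Defs.subst p G = meval mConst G p"
  by (simp add: subst_def meval_def mon_def)

lemma subst_hom: "comm_ring_hom (\<lambda>p. Defs.subst p G)"
  unfolding subst_eq_meval by (rule mConst.meval_hom)

interpretation subst: comm_ring_hom "\<lambda>p. Defs.subst p G" for G
  by (rule subst_hom)

lemma subst_mConst [simp]: "Defs.subst (mConst c) G = mConst c"
  by (simp add: subst_eq_meval mConst.meval_mConst)

lemma subst_mVar [simp]: "Defs.subst (mVar i) G = G i"
  by (simp add: subst_eq_meval mConst.meval_mVar)

lemma id_hom: "comm_ring_hom (\<lambda>x::'k::comm_ring_1. x)"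
  by unfold_locales simp_all

lemma evalp_eq_meval: "evalp p x = meval (\<lambda>x. x) x p"
  by (simp add: evalp_def meval_def mon_def)

interpretation evalp: comm_ring_hom "\<lambda>p. evalp p x" for x
  unfolding evalp_eq_meval by (rule comm_ring_hom.meval_hom[OF id_hom])

lemma evalp_mConst [simp]: "evalp (mConst c) x = c"
  by (simp add: evalp_eq_meval comm_ring_hom.meval_mConst[OF id_hom])

lemma evalp_mVar [simp]: "evalp (mVar i) x = x i"
  by (simp add: evalp_eq_meval comm_ring_hom.meval_mVar[OF id_hom])

lemma subst_subst: "Defs.subst (Defs.subst p G) H = Defs.subst p (\<lambda>i. Defs.subst (G i) H)"
  by (induction p rule: mpoly_induct) (simp_all add: subst.hom_add subst.hom_mult)

lemma evalp_subst: "evalp (Defs.subst p G) x = evalp p (\<lambda>i. evalp (G i) x)"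
  by (induction p rule: mpoly_induct)
    (simp_all add: subst.hom_add subst.hom_mult evalp.hom_add evalp.hom_mult)

subsection \<open>Coefficient and variable restrictions\<close>

lemma vars_in_mono: "vars_in V p \<Longrightarrow> V \<subseteq> W \<Longrightarrow> vars_in W p"
  by (auto simp: vars_in_def)

lemma vars_in_mConst [simp]: "vars_in V (mConst c)"
  by (simp add: vars_in_def mConst_def)

lemma vars_in_mVar [simp]: "i \<in> V \<Longrightarrow> vars_in V (mVar i)"
  by (simp add: vars_in_def mVar_def)

lemma vars_in_0 [simp]: "vars_in V 0"
  by (simp add: vars_in_def)

lemma vars_in_add: "vars_in V p \<Longrightarrow> vars_in V q \<Longrightarrow> vars_in V (p + q)"
  using Poly_Mapping.keys_add[of p q] by (auto simp: vars_in_def)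

lemma vars_in_uminus: "vars_in V p \<Longrightarrow> vars_in V (- p)"
  by (auto simp: vars_in_def in_keys_iff)

lemma vars_in_mult:
  assumes "vars_in V p" "vars_in V q"
  shows "vars_in V (p * q)"
  unfolding vars_in_def
proof
  fix a assume "a \<in> Poly_Mapping.keys (p * q)"
  then obtain b c where "a = b + c" "b \<in> Poly_Mapping.keys p" "c \<in> Poly_Mapping.keys q"
    using Poly_Mapping.keys_mult[of p q] by auto
  moreover from this have "Poly_Mapping.keys b \<subseteq> V" "Poly_Mapping.keys c \<subseteq> V"
    using assms by (auto simp: vars_in_def)
  ultimately show "Poly_Mapping.keys a \<subseteq> V"
    using Poly_Mapping.keys_add[of b c] by blast
qed

lemma vars_in_subst:
  assumes "vars_in V p" "\<And>i. i \<in> V \<Longrightarrow> vars_in W (G i)"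
  shows "vars_in W (Defs.subst p G)"
proof -
  have "coeffs_in UNIV p" by (simp add: coeffs_in_def)
  then show ?thesis using assms(1)
    by (induction rule: mpoly_induct_in)
      (auto simp: subst.hom_add subst.hom_mult intro: vars_in_add vars_in_mult assms(2))
qed

lemma subst_cong:
  assumes "vars_in V p" "\<And>i. i \<in> V \<Longrightarrow> G i = H i"
  shows "Defs.subst p G = Defs.subst p H"
proof -
  have "coeffs_in UNIV p" by (simp add: coeffs_in_def)
  then show ?thesis using assms(1)
    by (induction rule: mpoly_induct_in)
      (auto simp: subst.hom_add subst.hom_mult assms(2))
qed

lemma subst_mVars: "Defs.subst p mVar = p"
  by (induction p rule: mpoly_induct) (simp_all add: subst.hom_add subst.hom_mult)

lemma subst_ident:
  assumes "vars_in V p" "\<And>i. i \<in> V \<Longrightarrow> G i = mVar i"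
  shows "Defs.subst p G = p"
  using subst_cong[OF assms] by (simp add: subst_mVars)

lemma coeffs_in_lookup: "0 \<in> S \<Longrightarrow> coeffs_in S p \<longleftrightarrow> (\<forall>a. Poly_Mapping.lookup p a \<in> S)"
  unfolding coeffs_in_def by (metis in_keys_iff)

lemma coeffs_in_UNIV [simp]: "coeffs_in UNIV p"
  by (simp add: coeffs_in_def)

section \<open>Polynomials with coefficients in a subring\<close>

locale subring =
  fixes S :: "'k::comm_ring_1 set"
  assumes zero_in: "0 \<in> S" and one_in: "1 \<in> S"
    and add_in: "\<And>x y. x \<in> S \<Longrightarrow> y \<in> S \<Longrightarrow> x + y \<in> S"
    and mult_in: "\<And>x y. x \<in> S \<Longrightarrow> y \<in> S \<Longrightarrow> x * y \<in> S"
    and uminus_in: "\<And>x. x \<in> S \<Longrightarrow> - x \<in> S"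
begin

lemma coeffs_in_0: "coeffs_in S 0"
  by (simp add: coeffs_in_def)

lemma coeffs_in_mConst: "c \<in> S \<Longrightarrow> coeffs_in S (mConst c)"
  by (auto simp: coeffs_in_def mConst_def)

lemma coeffs_in_mVar: "coeffs_in S (mVar i)"
  by (auto simp: coeffs_in_def mVar_def one_in)

lemma coeffs_in_add: "coeffs_in S p \<Longrightarrow> coeffs_in S q \<Longrightarrow> coeffs_in S (p + q)"
  by (simp add: coeffs_in_lookup[OF zero_in] lookup_add add_in)

lemma coeffs_in_uminus: "coeffs_in S p \<Longrightarrow> coeffs_in S (- p)"
  by (simp add: coeffs_in_lookup[OF zero_in] uminus_in)

lemma coeffs_in_sum: "(\<And>i. i \<in> A \<Longrightarrow> coeffs_in S (f i)) \<Longrightarrow> coeffs_in S (sum f A)"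
  by (induction A rule: infinite_finite_induct) (auto intro: coeffs_in_0 coeffs_in_add)

lemma coeffs_in_mult:
  assumes "coeffs_in S p" "coeffs_in S q"
  shows "coeffs_in S (p * q)"
proof -
  have "p * q = (\<Sum>a\<in>Poly_Mapping.keys p. \<Sum>b\<in>Poly_Mapping.keys q.
      Poly_Mapping.single (a + b) (Poly_Mapping.lookup p a * Poly_Mapping.lookup q b))"
    by (subst mpoly_sum_single[of p], subst mpoly_sum_single[of q])
      (simp add: sum_product mult_single)
  moreover have "coeffs_in S (Poly_Mapping.single (a + b) (Poly_Mapping.lookup p a * Poly_Mapping.lookup q b))"
    if "a \<in> Poly_Mapping.keys p" "b \<in> Poly_Mapping.keys q" for a b
    using that assms by (auto simp: coeffs_in_def intro: mult_in)
  ultimately show ?thesis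
    by (simp add: coeffs_in_sum)
qed

lemma coeffs_in_subst:
  assumes "coeffs_in S p" "vars_in V p" "\<And>i. i \<in> V \<Longrightarrow> coeffs_in S (G i)"
  shows "coeffs_in S (Defs.subst p G)"
  using assms(1,2)
  by (induction rule: mpoly_induct_in)
    (auto simp: subst.hom_add subst.hom_mult intro: zero_in one_in coeffs_in_mConst coeffs_in_add coeffs_in_mult assms(3))

end

lemma subring_UNIV: "subring UNIV"
  by unfold_locales auto

subsection \<open>Elementary maps\<close>

lemma is_pmapD:
  assumes "is_pmap n S F"
  shows "i < n \<Longrightarrow> coeffs_in S (F i)" "i < n \<Longrightarrow> vars_in {..<n} (F i)" "i \<ge> n \<Longrightarrow> F i = 0"
  using assms by (auto simp: is_pmap_def)

lemma pcomp_assoc: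
  assumes "is_pmap n S G"
  shows "pcomp n (pcomp n F G) H = pcomp n F (pcomp n G H)"
proof
  fix i
  \<comment> \<open>The left side is not cut off at \<open>n\<close>, the right side is; they agree
    because \<open>G\<close> vanishes from index \<open>n\<close> on.\<close>
  have "(\<lambda>j. Defs.subst (G j) H) = pcomp n G H"
    using is_pmapD(3)[OF assms] by (auto simp: pcomp_def)
  then show "pcomp n (pcomp n F G) H i = pcomp n F (pcomp n G H) i"
    by (simp add: pcomp_def subst_subst)
qed

lemma pcomp_pid_left: "is_pmap n S G \<Longrightarrow> pcomp n (pid n) G = G"
  by (auto simp: pcomp_def pid_def is_pmap_def fun_eq_iff)

lemma pcomp_pid_right:
  assumes "is_pmap n S F"
  shows "pcomp n F (pid n) = F"
proof
  fix i
  show "pcomp n F (pid n) i = F i"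
  proof (cases "i < n")
    case True
    have "Defs.subst (F i) (pid n) = F i"
      by (rule subst_ident[OF is_pmapD(2)[OF assms True]]) (simp add: pid_def)
    with True show ?thesis by (simp add: pcomp_def)
  qed (use is_pmapD(3)[OF assms, of i] in \<open>simp add: pcomp_def\<close>)
qed

lemma pcomp_inverse_unique:
  assumes "is_pmap n S F" "is_pmap n S G" "is_pmap n S H"
    and "pcomp n G F = pid n" "pcomp n F H = pid n"
  shows "G = H"
  by (metis assms pcomp_assoc pcomp_pid_left pcomp_pid_right)

definition elmap :: "nat \<Rightarrow> nat \<Rightarrow> 'k::comm_ring_1 mpoly \<Rightarrow> 'k pmap" where
  "elmap n i f = (\<lambda>k. if k < n then (if k = i then mVar i + f else mVar k) else 0)"

text \<open>The linear alternative allows all transvections, also those that are not upper triangular;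
  with this restriction every elementary map is visibly triangular or affine.\<close>

definition elem_poly :: "nat \<Rightarrow> 'k::comm_ring_1 set \<Rightarrow> nat \<Rightarrow> 'k mpoly \<Rightarrow> bool" where
  "elem_poly n S i f \<longleftrightarrow> i < n \<and> coeffs_in S f \<and>
     (vars_in {i<..<n} f \<or> (\<exists>a\<in>S. \<exists>j<i. f = mConst a * mVar j))"

text \<open>Over a field, diagonal maps of determinant 1 are products of transvections, so one
  scaled coordinate is enough to carry the determinant. The last one is where elimination from left
  to right leaves it.\<close>

definition dscale :: "nat \<Rightarrow> 'k::comm_ring_1 \<Rightarrow> 'k pmap" where
  "dscale n d = (\<lambda>k. if k < n then (if Suc k = n then mConst d * mVar k else mVar k) else 0)"

text \<open>The group generated by the elementary maps, as words extended on the left; closure under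
  products and inverses is proved below.\<close>

inductive_set EA :: "nat \<Rightarrow> 'k::comm_ring_1 set \<Rightarrow> 'k pmap set" for n S where
  EA_pid: "pid n \<in> EA n S"
| EA_step: "elem_poly n S i f \<Longrightarrow> E \<in> EA n S \<Longrightarrow> pcomp n (elmap n i f) E \<in> EA n S"

text \<open>Both alternatives use only indices on one side of \<open>i\<close>. That
  \<open>f\<close> omits its own variable is what makes \<open>elmap n i f\<close> invertible with
  Jacobian determinant 1.\<close>

lemma elem_poly_vars: "elem_poly n S i f \<Longrightarrow> vars_in ({..<n} - {i}) f"
  unfolding elem_poly_def
  by (auto intro!: vars_in_mult elim!: vars_in_mono)

lemma elmap_inverse:
  assumes "elem_poly n S i f"
  shows "pcomp n (elmap n i f) (elmap n i (- f)) = pid n"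
proof -
  have "Defs.subst f (elmap n i (- f)) = f"
    by (rule subst_ident[OF elem_poly_vars[OF assms]]) (auto simp: elmap_def)
  then show ?thesis
    by (auto simp: fun_eq_iff pcomp_def elmap_def pid_def subst.hom_add)
qed

lemma dscale_mult: "pcomp n (dscale n a) (dscale n b) = dscale n (a * b)"
  by (auto simp: fun_eq_iff pcomp_def dscale_def subst.hom_mult mConst.hom_mult ac_simps)

lemma dscale_1: "dscale n 1 = pid n"
  by (auto simp: fun_eq_iff dscale_def pid_def)

section \<open>Calculus of elementary maps over a subring\<close>

context subring
begin

lemma elem_poly_uminus:
  assumes "elem_poly n S i f"
  shows "elem_poly n S i (- f)"
proof -
  have "\<exists>b\<in>S. - (mConst a * mVar j) = mConst b * mVar j" if "a \<in> S" for a j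
    using that by (intro bexI[of _ "- a"]) (auto simp: mConst.hom_uminus uminus_in)
  then show ?thesis
    using assms unfolding elem_poly_def
    by (auto intro!: coeffs_in_uminus intro: vars_in_uminus)
qed

lemma pid_pmap: "is_pmap n S (pid n)"
  by (auto simp: is_pmap_def pid_def coeffs_in_mVar)

lemma elmap_pmap:
  assumes "elem_poly n S i f"
  shows "is_pmap n S (elmap n i f)"
  using assms vars_in_mono[OF elem_poly_vars[OF assms], of "{..<n}"]
  by (auto simp: is_pmap_def elmap_def elem_poly_def coeffs_in_mVar
      intro!: coeffs_in_add vars_in_add)

lemma dscale_pmap: "d \<in> S \<Longrightarrow> is_pmap n S (dscale n d)"
  by (auto simp: is_pmap_def dscale_def coeffs_in_mVar
      intro!: coeffs_in_mult vars_in_mult coeffs_in_mConst)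

lemma pcomp_pmap:
  assumes "is_pmap n S F" "is_pmap n S G"
  shows "is_pmap n S (pcomp n F G)"
  using is_pmapD[OF assms(1)] is_pmapD[OF assms(2)]
  by (auto simp: is_pmap_def pcomp_def intro!: coeffs_in_subst[of _ "{..<n}"] vars_in_subst[of "{..<n}"])

lemma EA_pmap: "E \<in> EA n S \<Longrightarrow> is_pmap n S E"
  by (induction rule: EA.induct) (auto intro: pid_pmap elmap_pmap pcomp_pmap)

lemma EA_comp: "E \<in> EA n S \<Longrightarrow> E' \<in> EA n S \<Longrightarrow> pcomp n E E' \<in> EA n S"
  by (induction rule: EA.induct)
    (auto simp: pcomp_pid_left[OF EA_pmap] pcomp_assoc[OF EA_pmap] intro: EA_step)

lemma elmap_EA: "elem_poly n S i f \<Longrightarrow> elmap n i f \<in> EA n S"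
  using EA_step[OF _ EA_pid, of n S i f] by (simp add: pcomp_pid_right[OF elmap_pmap])

text \<open>The word is reversed and each of its polynomials is negated.\<close>

lemma EA_inverse:
  "E \<in> EA n S \<Longrightarrow> \<exists>E'\<in>EA n S. pcomp n E E' = pid n \<and> pcomp n E' E = pid n"
proof (induction rule: EA.induct)
  case EA_pid
  then show ?case
    by (intro bexI[of _ "pid n"]) (auto simp: pcomp_pid_left[OF pid_pmap] intro: EA.EA_pid)
next
  case (EA_step i f E)
  then obtain E' where E': "E' \<in> EA n S" "pcomp n E E' = pid n" "pcomp n E' E = pid n"
    by blast
  note f = elem_poly_uminus[OF EA_step(1)]
  note pm = EA_pmap[OF EA_step(2)] EA_pmap[OF E'(1)] elmap_pmap[OF f] elmap_pmap[OF EA_step(1)]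
  have inv: "pcomp n (elmap n i f) (elmap n i (- f)) = pid n"
    "pcomp n (elmap n i (- f)) (elmap n i f) = pid n"
    using elmap_inverse[OF EA_step(1)] elmap_inverse[OF f] by simp_all
  have "pcomp n E' (elmap n i (- f)) \<in> EA n S"
    by (intro EA_comp E' elmap_EA f)
  moreover have "pcomp n (pcomp n (elmap n i f) E) (pcomp n E' (elmap n i (- f))) = pid n"
    by (metis E'(2) inv(1) pm pcomp_assoc pcomp_pid_left)
  moreover have "pcomp n (pcomp n E' (elmap n i (- f))) (pcomp n (elmap n i f) E) = pid n"
    by (metis E'(3) inv(2) pm pcomp_assoc pcomp_pid_left)
  ultimately show ?case by blast
qed

text \<open>Diagonal maps normalize the elementary ones: conjugation rescales the last argument of
  \<open>f\<close> and, if \<open>i\<close> is the last index, also divides the result by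
  \<open>d\<close>.\<close>

lemma elmap_dscale:
  assumes f: "elem_poly n S i f" and d: "d \<in> S" "d' \<in> S" "d * d' = 1"
  shows "\<exists>f'. elem_poly n S i f' \<and>
    pcomp n (elmap n i f) (dscale n d) = pcomp n (dscale n d) (elmap n i f')"
proof -
  \<comment> \<open>\<open>u\<close> cancels the outer factor \<open>d\<close>, which is present
    only in the last component; indices start at 0, so that is \<open>Suc i = n\<close>.\<close>
  define u where "u = (if Suc i = n then d' else 1)"
  define f' where "f' = mConst u * Defs.subst f (dscale n d)"
  have u: "u \<in> S" using d one_in by (simp add: u_def)
  have i: "i < n" and cf: "coeffs_in S f" using f by (auto simp: elem_poly_def)
  have "coeffs_in S f'"
    unfolding f'_def using is_pmapD[OF dscale_pmap[OF d(1)], of _ n]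
    by (intro coeffs_in_mult coeffs_in_mConst u coeffs_in_subst[OF cf elem_poly_vars[OF f]]) auto
  moreover have "vars_in {i<..<n} f' \<or> (\<exists>a\<in>S. \<exists>j<i. f' = mConst a * mVar j)"
  proof (cases "vars_in {i<..<n} f")
    case True
    then have "vars_in {i<..<n} f'"
      unfolding f'_def
      by (intro vars_in_mult vars_in_mConst vars_in_subst[OF True])
        (auto simp: dscale_def intro!: vars_in_mult)
    then show ?thesis ..
  next
    case False
    then obtain a j where aj: "a \<in> S" "j < i" "f = mConst a * mVar j"
      using f by (auto simp: elem_poly_def)
    then have "f' = mConst (u * a) * mVar j"
      using i by (simp add: f'_def subst.hom_mult dscale_def mConst.hom_mult ac_simps)
    then show ?thesis using aj u mult_in by blast
  qed
  ultimately have "elem_poly n S i f'"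
    using i by (simp add: elem_poly_def)
  moreover have "mConst d * f' = Defs.subst f (dscale n d)" if "Suc i = n"
    using that d(3) by (simp add: f'_def u_def mult.assoc[symmetric] mConst.hom_mult[symmetric])
  then have "pcomp n (elmap n i f) (dscale n d) = pcomp n (dscale n d) (elmap n i f')"
    by (auto simp: fun_eq_iff pcomp_def elmap_def dscale_def subst.hom_add subst.hom_mult
        ring_distribs f'_def u_def)
  ultimately show ?thesis by blast
qed

text \<open>Moves a diagonal factor to the front of a whole word, one elementary factor at a
  time.\<close>

lemma EA_dscale:
  assumes "E \<in> EA n S" and d: "d \<in> S" "d' \<in> S" "d * d' = 1"
  shows "\<exists>E'\<in>EA n S. pcomp n E (dscale n d) = pcomp n (dscale n d) E'"
  using assms(1)
proof induction
  case EA_pid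
  then show ?case using EA.EA_pid
    by (intro bexI[of _ "pid n"])
      (auto simp: pcomp_pid_left[OF dscale_pmap[OF d(1)]] pcomp_pid_right[OF dscale_pmap[OF d(1)]])
next
  case (EA_step i f E)
  then obtain E' where E': "E' \<in> EA n S" "pcomp n E (dscale n d) = pcomp n (dscale n d) E'"
    by blast
  obtain f' where f': "elem_poly n S i f'"
    "pcomp n (elmap n i f) (dscale n d) = pcomp n (dscale n d) (elmap n i f')"
    using elmap_dscale[OF EA_step(1) d] by blast
  have "pcomp n (pcomp n (elmap n i f) E) (dscale n d) = pcomp n (dscale n d) (pcomp n (elmap n i f') E')"
    using pcomp_assoc[OF EA_pmap[OF EA_step(2)], of "elmap n i f" "dscale n d"]
      pcomp_assoc[OF dscale_pmap[OF d(1)], of n "elmap n i f" E']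
      pcomp_assoc[OF elmap_pmap[OF f'(1)], of "dscale n d" E']
    by (simp only: E'(2) f'(2))
  then show ?case using EA.EA_step[OF f'(1) E'(1)] by blast
qed

section \<open>Tameness of elementary maps\<close>

lemma triangular_elmap:
  assumes "vars_in {i<..<n} f" "elem_poly n S i f"
  shows "triangular_gen n S (elmap n i f)"
proof -
  have "unit_in S 1 \<and> coeffs_in S (if k = i then f else 0) \<and> vars_in {k<..<n} (if k = i then f else 0) \<and>
      elmap n i f k = mConst 1 * mVar k + (if k = i then f else 0)" if "k < n" for k
    using that assms by (auto simp: elmap_def elem_poly_def unit_in_def one_in coeffs_in_0)
  then show ?thesis
    using elmap_pmap[OF assms(2)] unfolding triangular_gen_def by blast
qed

lemma affine_elmap:
  assumes "a \<in> S" "j < i" "i < n"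
  shows "is_affine n S (elmap n i (mConst a * mVar j))"
proof -
  have "elem_poly n S i (mConst a * mVar j)"
    using assms by (auto simp: elem_poly_def intro!: coeffs_in_mult coeffs_in_mConst coeffs_in_mVar)
  note pm = elmap_pmap[OF this]
  have *: "mConst a * mVar j = Poly_Mapping.single (Poly_Mapping.single j 1) a"
    by (simp add: mConst_def mVar_def mult_single)
  have "(\<Sum>j\<in>Poly_Mapping.keys m. Poly_Mapping.lookup m j) \<le> 1"
    if "m \<in> Poly_Mapping.keys (elmap n i (mConst a * mVar j) k)" for m k
  proof -
    have "Poly_Mapping.keys (elmap n i (mConst a * mVar j) k)
        \<subseteq> {Poly_Mapping.single k 1, Poly_Mapping.single j 1}"
      unfolding elmap_def * using Poly_Mapping.keys_add[of "mVar i" "Poly_Mapping.single (Poly_Mapping.single j 1) a"]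
      by (auto simp: mVar_def split: if_splits)
    then show ?thesis using that by auto
  qed
  then show ?thesis using pm by (simp add: is_affine_def)
qed

lemma elmap_TA:
  assumes "elem_poly n S i f"
  shows "elmap n i f \<in> TA n S"
proof (cases "vars_in {i<..<n} f")
  case True
  then show ?thesis using TA.tri[OF triangular_elmap[OF _ assms]] by simp
next
  case False
  then obtain a j where aj: "a \<in> S" "j < i" "f = mConst a * mVar j" and i: "i < n"
    using assms by (auto simp: elem_poly_def)
  \<comment> \<open>An affine generator must come with an affine inverse; here it is the
    transvection with coefficient \<open>- a\<close>.\<close>
  have "is_affine n S (elmap n i f)" "is_affine n S (elmap n i (- f))"
    using affine_elmap[OF aj(1,2) i] affine_elmap[OF uminus_in[OF aj(1)] aj(2) i] aj(3)
    by (simp_all add: mConst.hom_uminus)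
  moreover have "pcomp n (elmap n i f) (elmap n i (- f)) = pid n"
    "pcomp n (elmap n i (- f)) (elmap n i f) = pid n"
    using elmap_inverse[OF assms] elmap_inverse[OF elem_poly_uminus[OF assms]] by simp_all
  ultimately have "affine_gen n S (elmap n i f)"
    unfolding affine_gen_def by blast
  then show ?thesis by (rule TA.aff)
qed

lemma dscale_TA:
  assumes "unit_in S d"
  shows "dscale n d \<in> TA n S"
proof (rule TA.tri)
  have "d \<in> S" using assms by (simp add: unit_in_def)
  have "unit_in S (if Suc k = n then d else 1) \<and> coeffs_in S 0 \<and> vars_in {k<..<n} (0 :: 'k mpoly) \<and>
      dscale n d k = mConst (if Suc k = n then d else 1) * mVar k + 0" if "k < n" for k
    using that assms by (auto simp: dscale_def unit_in_def one_in coeffs_in_0)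
  then show "triangular_gen n S (dscale n d)"
    using dscale_pmap[OF \<open>d \<in> S\<close>, of n] unfolding triangular_gen_def by blast
qed

lemma EA_TA: "E \<in> EA n S \<Longrightarrow> E \<in> TA n S"
proof (induction rule: EA.induct)
  case EA_pid
  \<comment> \<open>\<open>TA\<close> has no rule for the identity, which enters as the scaling by
    1.\<close>
  show ?case using dscale_TA[of 1 n] by (auto simp: dscale_1 unit_in_def one_in)
qed (auto intro: TA.comp elmap_TA)

end

subsection \<open>Normal form of tame maps over a field\<close>

definition lin :: "nat \<Rightarrow> (nat \<Rightarrow> nat \<Rightarrow> 'k::comm_ring_1) \<Rightarrow> 'k pmap" where
  "lin n A = (\<lambda>i. if i < n then \<Sum>j<n. mConst (A i j) * mVar j else 0)"

lemma lin_diag: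
  assumes "\<And>i j. i < n \<Longrightarrow> j < n \<Longrightarrow> A i j = (if i = j then a i else 0)"
  shows "lin n A = (\<lambda>i. if i < n then mConst (a i) * mVar i else 0)"
proof -
  have "(\<Sum>j<n. mConst (A i j) * mVar j) = mConst (a i) * mVar i" if "i < n" for i
  proof -
    have "(\<Sum>j<n. mConst (A i j) * mVar j) = (\<Sum>j<n. if j = i then mConst (a i) * mVar i else 0)"
      using assms that by (intro sum.cong) auto
    with that show ?thesis by simp
  qed
  then show ?thesis by (auto simp: lin_def)
qed

lemma evalp_lin: "i < n \<Longrightarrow> evalp (lin n A i) v = (\<Sum>j<n. A i j * v j)"
  by (simp add: lin_def evalp.hom_sum evalp.hom_mult)

definition rowop :: "nat \<Rightarrow> nat \<Rightarrow> 'k \<Rightarrow> (nat \<Rightarrow> nat \<Rightarrow> 'k) \<Rightarrow> nat \<Rightarrow> nat \<Rightarrow> 'k::comm_ring_1" where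
  "rowop i l a A = A(i := \<lambda>j. A i j + a * A l j)"

text \<open>Links matrices to maps: each row operation is an elementary factor on the left.\<close>

lemma pcomp_elmap_lin:
  assumes "i < n" "l < n"
  shows "pcomp n (elmap n i (mConst a * mVar l)) (lin n A) = lin n (rowop i l a A)"
  using assms
  by (auto simp: fun_eq_iff pcomp_def elmap_def lin_def rowop_def subst.hom_add subst.hom_mult
      mConst.hom_add mConst.hom_mult sum_distrib_left sum.distrib ring_distribs ac_simps)

lemma monomial_degree_le_1:
  fixes m :: "nat \<Rightarrow>\<^sub>0 nat"
  assumes "(\<Sum>j\<in>Poly_Mapping.keys m. Poly_Mapping.lookup m j) \<le> 1"
  shows "m = 0 \<or> (\<exists>j. m = Poly_Mapping.single j 1)"
proof (cases "m = 0")
  case False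
  then obtain j where j: "j \<in> Poly_Mapping.keys m" by fastforce
  have "Poly_Mapping.lookup m j + (\<Sum>i\<in>Poly_Mapping.keys m - {j}. Poly_Mapping.lookup m i) \<le> 1"
    using assms j by (simp add: sum.remove[symmetric])
  moreover have "Poly_Mapping.lookup m j \<ge> 1"
    using j by (simp add: in_keys_iff)
  ultimately have 1: "Poly_Mapping.lookup m j = 1" and "(\<Sum>i\<in>Poly_Mapping.keys m - {j}. Poly_Mapping.lookup m i) = 0"
    by linarith+
  then have "\<forall>i\<in>Poly_Mapping.keys m - {j}. Poly_Mapping.lookup m i = 0"
    by (subst (asm) sum_eq_0_iff) auto
  then have "Poly_Mapping.lookup m i = (if i = j then 1 else 0)" for i
    using 1 by (cases "i \<in> Poly_Mapping.keys m") (auto simp: not_in_keys_iff_lookup_eq_zero)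
  then have "m = Poly_Mapping.single j 1"
    by (intro poly_mapping_eqI) (auto simp: lookup_single when_def)
  then show ?thesis by blast
qed simp

lemma affine_eq_lin:
  assumes "is_affine n S H" "i < n"
  shows "H i = lin n (\<lambda>i j. Poly_Mapping.lookup (H i) (Poly_Mapping.single j 1)) i
    + mConst (Poly_Mapping.lookup (H i) 0)"
proof -
  define X where "X = (\<lambda>j. Poly_Mapping.single j (1::nat)) ` {..<n}"
  have inj: "inj_on (\<lambda>j. Poly_Mapping.single j (1::nat)) {..<n}"
    by (rule inj_onI) (metis keys_single singleton_inject zero_neq_one)
  have "0 \<notin> X" unfolding X_def by (auto dest: arg_cong[of _ _ Poly_Mapping.keys])
  have keys: "Poly_Mapping.keys (H i) \<subseteq> insert 0 X"
  proof
    fix m assume m: "m \<in> Poly_Mapping.keys (H i)"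
    then have "m = 0 \<or> (\<exists>j. m = Poly_Mapping.single j 1)"
      using assms by (intro monomial_degree_le_1) (auto simp: is_affine_def)
    moreover have "Poly_Mapping.keys m \<subseteq> {..<n}"
      using assms m by (auto simp: is_affine_def is_pmap_def vars_in_def)
    ultimately show "m \<in> insert 0 X" by (auto simp: X_def)
  qed
  have "H i = (\<Sum>a\<in>Poly_Mapping.keys (H i). Poly_Mapping.single a (Poly_Mapping.lookup (H i) a))"
    by (rule mpoly_sum_single)
  also have "\<dots> = (\<Sum>a\<in>insert 0 X. Poly_Mapping.single a (Poly_Mapping.lookup (H i) a))"
    using keys by (intro sum.mono_neutral_left) (auto simp: X_def in_keys_iff)
  also have "\<dots> = mConst (Poly_Mapping.lookup (H i) 0) + (\<Sum>a\<in>X. Poly_Mapping.single a (Poly_Mapping.lookup (H i) a))"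
    using \<open>0 \<notin> X\<close> by (simp add: X_def mConst_def)
  also have "(\<Sum>a\<in>X. Poly_Mapping.single a (Poly_Mapping.lookup (H i) a))
      = lin n (\<lambda>i j. Poly_Mapping.lookup (H i) (Poly_Mapping.single j 1)) i"
    using assms(2) unfolding X_def sum.reindex[OF inj]
    by (simp add: lin_def mConst_def mVar_def mult_single)
  finally show ?thesis by (simp add: add.commute)
qed

context subring
begin

text \<open>The \<open>f i\<close> are inserted in increasing order of \<open>i\<close>. At stage
  \<open>m\<close> the variables of \<open>f m\<close>, all of larger index, are still untouched, so
  composing with \<open>elmap n m (f m)\<close> on the left adds exactly \<open>f m\<close>.\<close>

lemma unitriangular_EA:
  assumes f: "\<And>i. i < n \<Longrightarrow> coeffs_in S (f i)" "\<And>i. i < n \<Longrightarrow> vars_in {i<..<n} (f i)"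
  shows "(\<lambda>i. if i < n then mVar i + f i else 0) \<in> EA n S"
proof -
  define U where "U m = (\<lambda>i. if i < n then mVar i + (if i < m then f i else 0) else 0)" for m
  have "U m \<in> EA n S" if "m \<le> n" for m
    using that
  proof (induction m)
    case 0
    have "U 0 = pid n" by (auto simp: U_def pid_def)
    then show ?case by (simp add: EA_pid)
  next
    case (Suc m)
    have "Defs.subst (f m) (U m) = f m"
      using Suc.prems by (intro subst_ident[OF f(2)]) (auto simp: U_def)
    then have "U (Suc m) = pcomp n (elmap n m (f m)) (U m)"
      using Suc.prems by (auto simp: fun_eq_iff U_def pcomp_def elmap_def subst.hom_add less_Suc_eq)
    moreover have "elem_poly n S m (f m)"
      using Suc.prems f by (auto simp: elem_poly_def)
    ultimately show ?case using Suc by (auto intro: EA_step)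
  qed
  moreover have "U n = (\<lambda>i. if i < n then mVar i + f i else 0)" by (auto simp: U_def)
  ultimately show ?thesis by force
qed

lemma elem_poly_transvection:
  assumes "i < n" "l < n" "i \<noteq> l" "a \<in> S"
  shows "elem_poly n S i (mConst a * mVar l)"
  using assms by (cases "l < i")
    (auto simp: elem_poly_def intro!: coeffs_in_mult coeffs_in_mConst coeffs_in_mVar vars_in_mult)

end

section \<open>The group of normal forms over a subfield\<close>

locale subfield = subring S for S :: "'k::field set" +
  assumes inverse_in: "\<And>x. x \<in> S \<Longrightarrow> inverse x \<in> S"
begin

lemma divide_in: "x \<in> S \<Longrightarrow> y \<in> S \<Longrightarrow> x / y \<in> S"
  by (simp add: divide_inverse mult_in inverse_in)

definition NF :: "nat \<Rightarrow> 'k pmap set" where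
  "NF n = {pcomp n (dscale n d) E | d E. d \<in> S \<and> d \<noteq> 0 \<and> E \<in> EA n S}"

lemma EA_NF: "E \<in> EA n S \<Longrightarrow> E \<in> NF n"
  unfolding NF_def by (auto intro!: exI[of _ 1] exI[of _ E] simp: dscale_1 pcomp_pid_left[OF EA_pmap] one_in)

lemma dscale_NF: "d \<in> S \<Longrightarrow> d \<noteq> 0 \<Longrightarrow> dscale n d \<in> NF n"
  unfolding NF_def
  by (auto intro!: exI[of _ d] exI[of _ "pid n"] simp: pcomp_pid_right[OF dscale_pmap] EA_pid)

lemma NF_pmap: "H \<in> NF n \<Longrightarrow> is_pmap n S H"
  by (auto simp: NF_def intro: pcomp_pmap dscale_pmap EA_pmap)

text \<open>The middle diagonal factor is moved left through the first word by
  \<open>EA_dscale\<close> and merges with the outer one.\<close>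

lemma NF_comp:
  assumes "H \<in> NF n" "K \<in> NF n"
  shows "pcomp n H K \<in> NF n"
proof -
  obtain a E where a: "a \<in> S" "a \<noteq> 0" "E \<in> EA n S" "H = pcomp n (dscale n a) E"
    using assms(1) by (auto simp: NF_def)
  obtain b E' where b: "b \<in> S" "b \<noteq> 0" "E' \<in> EA n S" "K = pcomp n (dscale n b) E'"
    using assms(2) by (auto simp: NF_def)
  obtain E'' where E'': "E'' \<in> EA n S" "pcomp n E (dscale n b) = pcomp n (dscale n b) E''"
    using EA_dscale[OF a(3) b(1) inverse_in[OF b(1)]] b(2) by auto
  have "pcomp n H K = pcomp n (dscale n a) (pcomp n (pcomp n E (dscale n b)) E')"
    by (simp add: a(4) b(4) pcomp_assoc[OF EA_pmap[OF a(3)]] pcomp_assoc[OF dscale_pmap[OF b(1)]])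
  also have "\<dots> = pcomp n (pcomp n (dscale n a) (dscale n b)) (pcomp n E'' E')"
    by (simp add: E''(2) pcomp_assoc[OF EA_pmap[OF E''(1)]] pcomp_assoc[OF dscale_pmap[OF b(1)]])
  finally have "pcomp n H K = pcomp n (dscale n (a * b)) (pcomp n E'' E')"
    by (simp add: dscale_mult)
  then show ?thesis
    unfolding NF_def using a b EA_comp[OF E''(1) b(3)] mult_in by (auto intro!: exI)
qed

text \<open>Inverting both factors and swapping them gives a right inverse \<open>K\<close>, normal
  by \<open>NF_comp\<close>. The given left inverse \<open>G\<close> must equal it.\<close>

lemma NF_inverse:
  assumes "H \<in> NF n" "is_inverse n S H G"
  shows "G \<in> NF n"
proof -
  obtain a E where a: "a \<in> S" "a \<noteq> 0" and E: "E \<in> EA n S" and H: "H = pcomp n (dscale n a) E"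
    using assms(1) by (auto simp: NF_def)
  obtain E' where E': "E' \<in> EA n S" "pcomp n E E' = pid n"
    using EA_inverse[OF E] by blast
  define K where "K = pcomp n E' (dscale n (inverse a))"
  have K: "K \<in> NF n"
    unfolding K_def using E' a by (intro NF_comp EA_NF dscale_NF inverse_in) auto
  note pm = EA_pmap[OF E] EA_pmap[OF E'(1)] dscale_pmap[OF a(1), of n] dscale_pmap[OF inverse_in[OF a(1)], of n]
  have "pcomp n H K = pcomp n (dscale n a) (pcomp n (pcomp n E E') (dscale n (inverse a)))"
    by (simp add: H K_def pcomp_assoc[OF pm(1)] pcomp_assoc[OF pm(2)])
  also have "\<dots> = pid n"
    using a by (simp add: E'(2) pcomp_pid_left[OF pm(4)] dscale_mult dscale_1)
  finally have "G = K"
    using assms(2) unfolding is_inverse_def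
    by (blast intro: pcomp_inverse_unique[OF NF_pmap[OF assms(1)] _ NF_pmap[OF K]])
  with K show ?thesis by simp
qed

text \<open>Gaussian elimination that clears columns from left to right. A pivot is normalised to 1 with
  the help of a row below it, hence the determinant ends up in the last diagonal entry.\<close>

definition reduced :: "nat \<Rightarrow> nat \<Rightarrow> (nat \<Rightarrow> nat \<Rightarrow> 'k) \<Rightarrow> bool" where
  "reduced n k A \<longleftrightarrow> (\<forall>i<n. \<forall>j<n. A i j \<in> S) \<and> (\<forall>i<n. \<forall>j<k. A i j = (if i = j then 1 else 0)) \<and>
     (\<forall>v. (\<forall>i<n. (\<Sum>j<n. A i j * v j) = 0) \<longrightarrow> (\<forall>j<n. v j = 0))"

text \<open>Row \<open>l\<close> is kept, so a kernel vector of the new matrix annihilates the old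
  rows \<open>l\<close> and \<open>i\<close> too. By \<open>k \<le> l\<close>, row \<open>l\<close>
  is zero in the first \<open>k\<close> columns, which therefore do not change.\<close>

lemma reduced_rowop:
  assumes A: "reduced n k A" and il: "i < n" "l < n" "i \<noteq> l" "k \<le> l" and a: "a \<in> S"
  shows "reduced n k (rowop i l a A)"
proof -
  have "\<forall>j<n. v j = 0" if v: "\<forall>r<n. (\<Sum>j<n. rowop i l a A r j * v j) = 0" for v
  proof -
    have l: "(\<Sum>j<n. A l j * v j) = 0" using v il by (auto simp: rowop_def)
    have "(\<Sum>j<n. rowop i l a A i j * v j) = (\<Sum>j<n. A i j * v j) + a * (\<Sum>j<n. A l j * v j)"
      by (simp add: rowop_def ring_distribs sum.distrib sum_distrib_left mult.assoc)
    then have "(\<Sum>j<n. A i j * v j) = 0" using v il l by simp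
    then have "\<forall>r<n. (\<Sum>j<n. A r j * v j) = 0" using v by (auto simp: rowop_def split: if_splits)
    then show ?thesis using A unfolding reduced_def by blast
  qed
  then show ?thesis
    using A il a unfolding reduced_def by (auto simp: rowop_def intro!: add_in mult_in)
qed

lemma lin_rowop_NF:
  assumes "i < n" "l < n" "i \<noteq> l" "a \<in> S" "lin n (rowop i l a A) \<in> NF n"
  shows "lin n A \<in> NF n"
proof -
  have "rowop i l (- a) (rowop i l a A) = A"
    using assms(3) by (auto simp: rowop_def fun_eq_iff)
  then have "lin n A = pcomp n (elmap n i (mConst (- a) * mVar l)) (lin n (rowop i l a A))"
    using pcomp_elmap_lin[OF assms(1,2), of "- a" "rowop i l a A"] by simp
  then show ?thesis
    using assms NF_comp[OF EA_NF[OF elmap_EA[OF elem_poly_transvection]]] uminus_in by simp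
qed

text \<open>Row \<open>k\<close> is not in \<open>I\<close>, so it stays fixed and the changes to
  the other rows can be made one by one.\<close>

lemma clear_column:
  assumes A: "reduced n k A" and k: "k < n" and w: "\<And>i. i < n \<Longrightarrow> w i \<in> S"
    and "finite I" "I \<subseteq> {..<n} - {k}"
  defines "B \<equiv> \<lambda>I i. (if i \<in> I then (\<lambda>j. A i j + w i * A k j) else A i)"
  shows "reduced n k (B I) \<and> (lin n (B I) \<in> NF n \<longrightarrow> lin n A \<in> NF n)"
  using assms(4,5)
proof (induction I)
  case empty
  then show ?case using A by (simp add: B_def)
next
  case (insert i I)
  have "B (insert i I) = rowop i k (w i) (B I)"
    using insert by (auto simp: B_def rowop_def fun_eq_iff)
  then show ?case
    using insert k w reduced_rowop[of n k "B I" i k "w i"] lin_rowop_NF[of i n k "w i" "B I"] by auto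
qed

text \<open>Otherwise column \<open>k\<close> would be a combination of the unit columns before it,
  and the coefficients of this relation form the kernel vector \<open>v\<close> with
  \<open>v k = 1\<close>.\<close>

lemma reduced_pivot:
  assumes A: "reduced n k A" and k: "k < n"
  shows "\<exists>i<n. k \<le> i \<and> A i k \<noteq> 0"
proof (rule ccontr)
  assume contra: "\<not> (\<exists>i<n. k \<le> i \<and> A i k \<noteq> 0)"
  define v where "v j = (if j < k then - A j k else if j = k then 1 else 0)" for j
  have "(\<Sum>j<n. A i j * v j) = 0" if i: "i < n" for i
  proof -
    have "(\<Sum>j<n. A i j * v j)
        = (\<Sum>j<n. (if j = i then (if i < k then - A i k else 0) else 0) + (if j = k then A i k else 0))"
      using A i by (intro sum.cong) (auto simp: v_def reduced_def)
    also have "\<dots> = 0"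
      using i k contra by (auto simp: sum.distrib not_less)
    finally show ?thesis .
  qed
  then have "v k = 0" using A k unfolding reduced_def by blast
  then show False by (simp add: v_def)
qed

lemma reduced_clear:
  assumes A: "reduced n k A" and k: "k < n" and p: "A k k \<noteq> 0"
  obtains B where "reduced n k B" "lin n B \<in> NF n \<Longrightarrow> lin n A \<in> NF n"
    "B k k = A k k" "\<And>i. i < n \<Longrightarrow> i \<noteq> k \<Longrightarrow> B i k = 0"
proof -
  define w where "w i = - (A i k / A k k)" for i
  have "w i \<in> S" if "i < n" for i
    using A k that by (auto simp: w_def reduced_def intro!: uminus_in divide_in)
  then have "reduced n k (\<lambda>i. if i \<in> {..<n} - {k} then (\<lambda>j. A i j + w i * A k j) else A i) \<and>
      (lin n (\<lambda>i. if i \<in> {..<n} - {k} then (\<lambda>j. A i j + w i * A k j) else A i) \<in> NF n \<longrightarrow> lin n A \<in> NF n)"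
    by (intro clear_column[OF A k]) auto
  then show ?thesis
    using p by (intro that[of "\<lambda>i. if i \<in> {..<n} - {k} then (\<lambda>j. A i j + w i * A k j) else A i"])
      (auto simp: w_def)
qed

text \<open>Induction on the number of columns still to be treated after column \<open>k\<close>. In
  the last column no row is left to normalize the pivot, which remains as the scalar of
  \<open>dscale\<close>.\<close>

lemma reduced_NF:
  assumes "k < n" "reduced n k A"
  shows "lin n A \<in> NF n"
  using assms
proof (induction "n - Suc k" arbitrary: k A)
  case 0
  then have n: "n = Suc k" by simp
  have p: "A k k \<noteq> 0" using reduced_pivot[OF 0(3,2)] n by (metis le_antisym less_Suc_eq_le)
  obtain B where B: "reduced n k B" "lin n B \<in> NF n \<Longrightarrow> lin n A \<in> NF n"
    "B k k = A k k" "\<And>i. i < n \<Longrightarrow> i \<noteq> k \<Longrightarrow> B i k = 0"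
    using reduced_clear[OF 0(3,2) p] by metis
  have "lin n B = (\<lambda>i. if i < n then mConst (if i = k then A k k else 1) * mVar i else 0)"
  proof (rule lin_diag)
    fix i j assume "i < n" "j < n"
    moreover have "B i j = (if i = j then 1 else 0)" if "i < n" "j < k" for i j
      using B(1) that unfolding reduced_def by blast
    ultimately show "B i j = (if i = j then if i = k then A k k else 1 else 0)"
      using B(3,4) n by (cases "j = k") auto
  qed
  also have "\<dots> = dscale n (A k k)"
    using n by (auto simp: dscale_def fun_eq_iff)
  finally show ?case
    using B(2) dscale_NF[OF _ p] 0(3) n by (auto simp: reduced_def)
next
  case (Suc d)
  have k: "Suc k < n" "d = n - Suc (Suc k)" using Suc by auto
  \<comment> \<open>Once the pivot is 1, clearing the rest of its column makes one more column a
    unit column, and the induction hypothesis applies.\<close>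
  have one: "lin n A \<in> NF n" if A: "reduced n k A" "A k k = 1" for A
  proof -
    have "A k k \<noteq> 0" using A by simp
    from reduced_clear[OF A(1) Suc(3) this]
    obtain B where B: "reduced n k B" "lin n B \<in> NF n \<Longrightarrow> lin n A \<in> NF n"
      "B k k = A k k" "\<And>i. i < n \<Longrightarrow> i \<noteq> k \<Longrightarrow> B i k = 0" by metis
    have "B i j = (if i = j then 1 else 0)" if "i < n" "j < Suc k" for i j
    proof (cases "j = k")
      case False
      then show ?thesis using B(1) that unfolding reduced_def by (metis less_antisym)
    qed (use B(3,4) A(2) that in auto)
    then have "reduced n (Suc k) B"
      using B(1) unfolding reduced_def by blast
    then show ?thesis using Suc(1)[OF k(2,1)] B(2) by blast
  qed
  \<comment> \<open>A nonzero entry below the pivot position allows \<open>a\<close> to be chosen so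
    that adding \<open>a\<close> times its row turns the pivot into 1.\<close>
  have below: "lin n A \<in> NF n" if A: "reduced n k A" "i < n" "k < i" "A i k \<noteq> 0" for A i
  proof -
    define a where "a = (1 - A k k) / A i k"
    have "a \<in> S"
      using A Suc(3) uminus_in add_in[OF one_in, of "- A k k"] unfolding a_def reduced_def
      by (auto intro!: divide_in)
    moreover have "rowop k i a A k k = 1" using A by (simp add: rowop_def a_def)
    ultimately have "lin n (rowop k i a A) \<in> NF n"
      using A Suc(3) by (intro one[OF reduced_rowop]) auto
    then show ?thesis
      using lin_rowop_NF[of k n i a A] A Suc(3) \<open>a \<in> S\<close> by simp
  qed
  obtain i where i: "i < n" "k \<le> i" "A i k \<noteq> 0" using reduced_pivot[OF Suc(4,3)] by blast
  show ?case
  proof (cases "\<exists>i. i < n \<and> k < i \<and> A i k \<noteq> 0")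
    case True
    then show ?thesis using below Suc(4) by blast
  next
    case False
    \<comment> \<open>The pivot is the only nonzero entry available, so row \<open>k\<close> is
      first added to row \<open>Suc k\<close> to reach the situation of
      \<open>below\<close>.\<close>
    then have "A k k \<noteq> 0" "A (Suc k) k = 0" using i k by (auto simp: le_less)
    then have "rowop (Suc k) k 1 A (Suc k) k \<noteq> 0" by (simp add: rowop_def)
    then have "lin n (rowop (Suc k) k 1 A) \<in> NF n"
      using k Suc(3,4) one_in by (intro below[OF reduced_rowop]) auto
    then show ?thesis
      using lin_rowop_NF[of "Suc k" n k 1 A] k Suc(3) one_in by simp
  qed
qed

lemma lin_NF:
  assumes "reduced n 0 A"
  shows "lin n A \<in> NF n"
proof (cases "n = 0")
  case True
  then have "lin n A = pid n" by (auto simp: lin_def pid_def)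
  then show ?thesis by (simp add: EA_NF EA_pid)
qed (use assms reduced_NF[of 0 n A] in auto)

text \<open>An affine map is a translation after its linear part. A kernel vector of the linear part
  has the same image under \<open>H\<close> as the origin, and the left inverse \<open>G\<close>
  forces it to be zero.\<close>

lemma affine_NF:
  assumes "affine_gen n S H"
  shows "H \<in> NF n"
proof -
  define A where "A i j = Poly_Mapping.lookup (H i) (Poly_Mapping.single j 1)" for i j
  define b where "b i = Poly_Mapping.lookup (H i) 0" for i
  have H: "is_affine n S H" using assms by (simp add: affine_gen_def)
  obtain G where G: "pcomp n G H = pid n" using assms by (auto simp: affine_gen_def)
  have pm: "is_pmap n S H" using H by (simp add: is_affine_def)
  have Hi: "H i = lin n A i + mConst (b i)" if "i < n" for i
    using affine_eq_lin[OF H that] by (simp add: A_def[abs_def] b_def)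
  have in_S: "A i j \<in> S" "b i \<in> S" if "i < n" for i j
    using is_pmapD(1)[OF pm that] by (simp_all add: A_def b_def coeffs_in_lookup zero_in)
  have "\<forall>j<n. v j = 0" if v: "\<forall>i<n. (\<Sum>j<n. A i j * v j) = 0" for v
  proof (intro allI impI)
    fix j assume j: "j < n"
    have "evalp (H i) v = evalp (H i) (\<lambda>_. 0)" for i
      using v Hi[of i] is_pmapD(3)[OF pm, of i]
      by (cases "i < n") (auto simp: evalp.hom_add evalp_lin)
    then have "evalp (pcomp n G H j) v = evalp (pcomp n G H j) (\<lambda>_. 0)"
      using j by (simp add: pcomp_def evalp_subst)
    then show "v j = 0" using j by (simp add: G pid_def)
  qed
  then have "lin n A \<in> NF n"
    by (intro lin_NF) (auto simp: reduced_def in_S)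
  moreover have "(\<lambda>i. if i < n then mVar i + mConst (b i) else 0) \<in> EA n S"
    by (intro unitriangular_EA) (auto intro: coeffs_in_mConst in_S)
  moreover have "H = pcomp n (\<lambda>i. if i < n then mVar i + mConst (b i) else 0) (lin n A)"
    using Hi is_pmapD(3)[OF pm] by (auto simp: fun_eq_iff pcomp_def subst.hom_add)
  ultimately show ?thesis using NF_comp EA_NF by simp
qed

text \<open>The units \<open>a i\<close> are split off as a diagonal map on the left, which leaves a
  unitriangular map with entries divided by \<open>a i\<close>. The diagonal map is handled by
  elimination.\<close>

lemma triangular_NF:
  assumes "triangular_gen n S H"
  shows "H \<in> NF n"
proof -
  have pm: "is_pmap n S H" using assms by (simp add: triangular_gen_def)
  obtain a f where af: "\<And>i. i < n \<Longrightarrow> unit_in S (a i)" "\<And>i. i < n \<Longrightarrow> coeffs_in S (f i)"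
    "\<And>i. i < n \<Longrightarrow> vars_in {i<..<n} (f i)" "\<And>i. i < n \<Longrightarrow> H i = mConst (a i) * mVar i + f i"
    using assms unfolding triangular_gen_def by metis
  have a: "a i \<in> S" "a i \<noteq> 0" if "i < n" for i using af(1)[OF that] by (auto simp: unit_in_def)
  define A where "A i j = (if i = j then a i else 0)" for i j
  have L: "lin n A = (\<lambda>i. if i < n then mConst (a i) * mVar i else 0)"
    by (rule lin_diag) (simp add: A_def)
  have "(\<Sum>j<n. A i j * v j) = a i * v i" if "i < n" for i v
    using that by (simp add: A_def if_distrib[of "\<lambda>x. x * _"] cong: if_cong)
  then have "reduced n 0 A"
    using a by (auto simp: reduced_def) (auto simp: A_def zero_in)
  then have "lin n A \<in> NF n" by (rule lin_NF)
  moreover have "(\<lambda>i. if i < n then mVar i + mConst (inverse (a i)) * f i else 0) \<in> EA n S"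
    using af a by (intro unitriangular_EA) (auto intro!: coeffs_in_mult coeffs_in_mConst vars_in_mult inverse_in)
  moreover have "mConst (a i) * (mConst (inverse (a i)) * f i) = f i" if "i < n" for i
    using a[OF that] by (simp add: mult.assoc[symmetric] mConst.hom_mult[symmetric])
  then have "H = pcomp n (lin n A) (\<lambda>i. if i < n then mVar i + mConst (inverse (a i)) * f i else 0)"
    using af(4) is_pmapD(3)[OF pm] by (auto simp: fun_eq_iff pcomp_def L subst.hom_mult ring_distribs)
  ultimately show ?thesis using NF_comp EA_NF by simp
qed

lemma TA_NF: "H \<in> TA n S \<Longrightarrow> H \<in> NF n"
  by (induction rule: TA.induct) (auto intro: affine_NF triangular_NF NF_comp NF_inverse)

end

subsection \<open>Jacobian determinants\<close>

text \<open>Directional derivatives via dual numbers: the coefficient of \<open>\<epsilon>\<close> in \<open>p(x + \<epsilon> v)\<close>.\<close>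

definition dual :: "'k::comm_ring_1 mpoly \<Rightarrow> (nat \<Rightarrow> 'k) \<Rightarrow> (nat \<Rightarrow> 'k) \<Rightarrow> 'k poly" where
  "dual p x v = meval (\<lambda>a. [:a:]) (\<lambda>i. [:x i, v i:]) p"

definition pder :: "'k::comm_ring_1 mpoly \<Rightarrow> (nat \<Rightarrow> 'k) \<Rightarrow> (nat \<Rightarrow> 'k) \<Rightarrow> 'k" where
  "pder p x v = poly.coeff (dual p x v) 1"

lemma const_poly_hom: "comm_ring_hom (\<lambda>a::'k::comm_ring_1. [:a:])"
  by unfold_locales (simp_all add: one_pCons)

interpretation dual: comm_ring_hom "\<lambda>p. dual p x v" for x v
  unfolding dual_def by (rule comm_ring_hom.meval_hom[OF const_poly_hom])

lemma dual_mConst [simp]: "dual (mConst c) x v = [:c:]"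
  by (simp add: dual_def comm_ring_hom.meval_mConst[OF const_poly_hom])

lemma dual_mVar [simp]: "dual (mVar i) x v = [:x i, v i:]"
  by (simp add: dual_def comm_ring_hom.meval_mVar[OF const_poly_hom])

lemma coeff_dual_0: "poly.coeff (dual p x v) 0 = evalp p x"
  by (induction p rule: mpoly_induct)
    (simp_all add: dual.hom_add dual.hom_mult evalp.hom_add evalp.hom_mult coeff_mult)

lemma pder_mConst [simp]: "pder (mConst c) x v = 0"
  by (simp add: pder_def)

lemma pder_mVar [simp]: "pder (mVar i) x v = v i"
  by (simp add: pder_def)

lemma pder_add: "pder (p + q) x v = pder p x v + pder q x v"
  by (simp add: pder_def dual.hom_add)

lemma pder_mult: "pder (p * q) x v = evalp p x * pder q x v + pder p x v * evalp q x"
  by (simp add: pder_def dual.hom_mult coeff_mult coeff_dual_0)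

lemma pder_0 [simp]: "pder 0 x v = 0"
  by (simp add: pder_def)

text \<open>The chain rule: both sides obey the same sum and product rules and agree on constants
  and variables.\<close>

lemma pder_subst:
  "pder (Defs.subst p G) x v = pder p (\<lambda>i. evalp (G i) x) (\<lambda>i. pder (G i) x v)"
  by (induction p rule: mpoly_induct)
    (simp_all add: subst.hom_add subst.hom_mult pder_add pder_mult evalp_subst)

lemma pder_vars_in:
  assumes "vars_in V p" "\<And>i. i \<in> V \<Longrightarrow> v i = 0"
  shows "pder p x v = 0"
proof -
  have "coeffs_in UNIV p" by simp
  then show ?thesis using assms(1)
    by (induction rule: mpoly_induct_in) (auto simp: pder_add pder_mult assms(2))
qed

definition unitv :: "nat \<Rightarrow> nat \<Rightarrow> 'k::comm_ring_1" where
  "unitv j = (\<lambda>k. if k = j then 1 else 0)"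

lemma pder_linear:
  assumes "\<And>j. j \<ge> n \<Longrightarrow> v j = 0"
  shows "pder p x v = (\<Sum>j<n. pder p x (unitv j) * v j)"
proof (induction p rule: mpoly_induct)
  case (var i)
  have "(\<Sum>j<n. unitv j i * v j) = (\<Sum>j<n. if j = i then v i else 0)"
    by (intro sum.cong) (auto simp: unitv_def)
  also have "\<dots> = v i" using assms[of i] by auto
  finally show ?case by simp
qed (simp_all add: pder_add pder_mult sum.distrib ring_distribs sum_distrib_left sum_distrib_right ac_simps)

text \<open>The Jacobian matrix at a point, so its determinant lies in the coefficient ring, where
  units are easy to recognize.\<close>

definition jac :: "nat \<Rightarrow> 'k::comm_ring_1 pmap \<Rightarrow> (nat \<Rightarrow> 'k) \<Rightarrow> 'k mat" where
  "jac n F x = mat n n (\<lambda>(i, j). pder (F i) x (unitv j))"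

lemma jac_carrier [simp]: "jac n F x \<in> carrier_mat n n"
  by (simp add: jac_def)

lemma jac_index: "i < n \<Longrightarrow> j < n \<Longrightarrow> jac n F x $$ (i, j) = pder (F i) x (unitv j)"
  by (simp add: jac_def)

lemma jac_pcomp:
  assumes "is_pmap n S G"
  shows "jac n (pcomp n F G) x = jac n F (\<lambda>i. evalp (G i) x) * jac n G x"
proof (rule eq_matI)
  fix i j assume "i < dim_row (jac n F (\<lambda>i. evalp (G i) x) * jac n G x)"
    "j < dim_col (jac n F (\<lambda>i. evalp (G i) x) * jac n G x)"
  then have ij: "i < n" "j < n" by (simp_all add: jac_def)
  have "pder (F i) (\<lambda>i. evalp (G i) x) (\<lambda>k. pder (G k) x (unitv j))
      = (\<Sum>k<n. pder (F i) (\<lambda>i. evalp (G i) x) (unitv k) * pder (G k) x (unitv j))"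
    using is_pmapD(3)[OF assms] by (intro pder_linear) simp
  then show "jac n (pcomp n F G) x $$ (i, j) = (jac n F (\<lambda>i. evalp (G i) x) * jac n G x) $$ (i, j)"
    using ij by (simp add: jac_index pcomp_def pder_subst)
      (simp add: jac_def scalar_prod_def lessThan_atLeast0)
qed (simp_all add: jac_def)

lemma det_jac_pcomp:
  assumes "is_pmap n S G"
  shows "det (jac n (pcomp n F G) x) = det (jac n F (\<lambda>i. evalp (G i) x)) * det (jac n G x)"
  unfolding jac_pcomp[OF assms] by (rule det_mult[of _ n]) simp_all

lemma det_jac_upper:
  assumes "\<And>i j. i < n \<Longrightarrow> j < i \<Longrightarrow> pder (F i) x (unitv j) = 0"
  shows "det (jac n F x) = (\<Prod>i<n. pder (F i) x (unitv i))"
proof -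
  have "upper_triangular (jac n F x)"
    using assms by (auto simp: upper_triangular_def jac_def)
  then have "det (jac n F x) = prod_list (diag_mat (jac n F x))"
    by (rule det_upper_triangular[of _ n]) simp
  then show ?thesis
    by (simp add: prod_list_diag_prod jac_def lessThan_atLeast0)
qed

lemma det_jac_lower:
  assumes "\<And>i j. i < j \<Longrightarrow> j < n \<Longrightarrow> pder (F i) x (unitv j) = 0"
  shows "det (jac n F x) = (\<Prod>i<n. pder (F i) x (unitv i))"
proof -
  have "det (jac n F x) = prod_list (diag_mat (jac n F x))"
    using assms by (intro det_lower_triangular[of n]) (auto simp: jac_def)
  then show ?thesis
    by (simp add: prod_list_diag_prod jac_def lessThan_atLeast0)
qed

lemma det_jac_pid: "det (jac n (pid n) x) = 1"
  by (subst det_jac_upper) (auto simp: pid_def unitv_def)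

lemma det_jac_dscale: "n > 0 \<Longrightarrow> det (jac n (dscale n d) x) = d"
proof -
  assume "n > 0"
  then obtain k where n: "n = Suc k" by (cases n) auto
  show ?thesis
    by (subst det_jac_upper) (auto simp: n dscale_def unitv_def pder_mult lessThan_Suc)
qed

text \<open>The Jacobian differs from the identity in row \<open>i\<close> only. It is upper
  triangular if \<open>f\<close> uses later variables and lower triangular in the linear
  alternative; the diagonal consists of ones because \<open>f\<close> omits variable
  \<open>i\<close>.\<close>

lemma det_jac_elmap:
  assumes "elem_poly n S i f"
  shows "det (jac n (elmap n i f) x) = 1"
proof -
  have d: "pder (elmap n i f k) x (unitv j) = unitv j k + (if k = i then pder f x (unitv j) else 0)"
    if "k < n" for k j
    using that by (simp add: elmap_def pder_add)
  have f0: "pder f x (unitv i) = 0"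
    by (rule pder_vars_in[OF elem_poly_vars[OF assms]]) (auto simp: unitv_def)
  have "det (jac n (elmap n i f) x) = (\<Prod>k<n. pder (elmap n i f k) x (unitv k))"
  proof (cases "vars_in {i<..<n} f")
    case True
    show ?thesis
      by (rule det_jac_upper) (auto simp: d, auto simp: unitv_def intro!: pder_vars_in[OF True])
  next
    case False
    then obtain a j where "j < i" "f = mConst a * mVar j"
      using assms by (auto simp: elem_poly_def)
    then have "vars_in {..<i} f" by (auto intro!: vars_in_mult)
    then show ?thesis
      by (intro det_jac_lower) (auto simp: d, auto simp: unitv_def elim!: pder_vars_in)
  qed
  also have "\<dots> = 1"
    by (intro prod.neutral) (auto simp: d f0, auto simp: unitv_def)
  finally show ?thesis .
qed

lemma (in subring) det_jac_EA: "E \<in> EA n S \<Longrightarrow> det (jac n E x) = 1"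
  by (induction rule: EA.induct)
    (simp_all add: det_jac_pid det_jac_pcomp[OF EA_pmap] det_jac_elmap)

text \<open>The chain rule for an inverse \<open>G\<close> after \<open>F\<close> exhibits the
  determinant as a factor of 1.\<close>

lemma det_jac_GA_unit:
  assumes "F \<in> GA n S"
  shows "det (jac n F x) dvd 1"
proof -
  obtain G where "is_pmap n S F" "pcomp n G F = pid n"
    using assms by (auto simp: GA_def is_inverse_def)
  then show ?thesis
    using det_jac_pcomp[of n S F G x] by (simp add: det_jac_pid) (metis dvd_triv_right)
qed

subsection \<open>Specialization at the roots of \<open>c\<^sup>N = c\<close>\<close>

text \<open>\<open>N\<close> will be \<open>q ^ m\<close>, which makes \<open>C\<close> the copy of
  the field with \<open>q ^ m\<close> elements inside the target field.\<close>

locale specialization =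
  fixes \<iota> :: "'a::{finite,field} \<Rightarrow> 'b::field" and N :: nat
  assumes hom: "ring_hom_fun \<iota>" and N: "N \<ge> 2" and finite_C: "finite {c::'b. c ^ N = c}"
begin

definition C :: "'b set" where "C = {c. c ^ N = c}"

definition ev :: "'b \<Rightarrow> 'a poly \<Rightarrow> 'b" where "ev c h = poly (map_poly \<iota> h) c"

lemma \<iota>_hom: "comm_ring_hom \<iota>"
proof -
  have "\<iota> 0 + \<iota> 0 = \<iota> 0" using hom unfolding ring_hom_fun_def by (metis add_0)
  then have "\<iota> 0 = 0" by (metis add_0 add_right_cancel)
  then show ?thesis
    using hom by unfold_locales (auto simp: ring_hom_fun_def)
qed

sublocale \<iota>: comm_ring_hom \<iota>
  by (rule \<iota>_hom)

sublocale \<iota>p: map_poly_comm_ring_hom \<iota> ..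

sublocale ev: comm_ring_hom "ev c" for c
  by unfold_locales (simp_all add: ev_def \<iota>p.hom_add \<iota>p.hom_mult)

lemma ev_const [simp]: "ev c [:a:] = \<iota> a"
  by (simp add: ev_def \<iota>.map_poly_pCons_hom)

text \<open>Since \<open>c\<close> is a root of \<open>g = X ^ N - X\<close>, values at
  \<open>c\<close> depend only on remainders modulo \<open>g\<close>. There are finitely many of
  these over a finite field.\<close>

lemma finite_range_ev:
  assumes "c \<in> C"
  shows "finite (range (ev c))"
proof -
  define g :: "'a poly" where "g = monom 1 N - monom 1 1"
  have "poly.coeff g N \<noteq> 0" using N by (simp add: g_def)
  then have g0: "g \<noteq> 0" by auto
  have "map_poly \<iota> g = monom 1 N - monom 1 1"
    by (simp add: g_def \<iota>p.hom_minus)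
  then have "ev c g = 0"
    using assms by (simp add: ev_def C_def poly_monom)
  then have mod: "ev c h = ev c (h mod g)" for h
    using ev.hom_add[of c "h div g * g" "h mod g"] by (simp add: ev.hom_mult)
  \<comment> \<open>Remainders are encoded by their coefficient lists, whose number is finite by the
    length bound.\<close>
  have "range (ev c) \<subseteq> (\<lambda>xs. ev c (Poly xs)) ` {xs. set xs \<subseteq> UNIV \<and> length xs \<le> Suc (degree g)}"
  proof
    fix y assume "y \<in> range (ev c)"
    then obtain h where "y = ev c (h mod g)" using mod by blast
    moreover have "degree (h mod g) \<le> degree g"
      using degree_mod_less[OF g0, of h] by auto
    then have "length (coeffs (h mod g)) \<le> Suc (degree g)"
      by (cases "h mod g = 0") (auto simp: length_coeffs_degree)
    ultimately show "y \<in> (\<lambda>xs. ev c (Poly xs)) ` {xs. set xs \<subseteq> UNIV \<and> length xs \<le> Suc (degree g)}"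
      by (intro image_eqI[of _ _ "coeffs (h mod g)"]) auto
  qed
  then show ?thesis
    by (rule finite_subset) (intro finite_imageI finite_lists_length_le, simp)
qed

text \<open>Pigeonhole: the powers lie in a finite set, so two of them coincide, and the smaller one
  cancels.\<close>

lemma ev_power_eq_1:
  assumes "c \<in> C" "ev c h \<noteq> 0"
  shows "\<exists>k>0. ev c h ^ k = 1"
proof -
  have "finite (range (\<lambda>k. ev c h ^ k))"
    by (rule finite_subset[OF _ finite_range_ev[OF assms(1)]]) (auto simp flip: ev.hom_power)
  then have "\<not> inj (\<lambda>k. ev c h ^ k)"
    using range_inj_infinite by blast
  then obtain i j where ij: "i < j" "ev c h ^ i = ev c h ^ j"
    unfolding inj_def by (metis linorder_neqE_nat)
  then have "ev c h ^ i * ev c h ^ (j - i) = ev c h ^ i * 1"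
    by (metis le_add_diff_inverse less_imp_le mult_1_right power_add)
  then have "ev c h ^ (j - i) = 1" using assms(2) by simp
  with ij show ?thesis by (intro exI[of _ "j - i"]) auto
qed

text \<open>The ring of values at \<open>c\<close> is already a field: if \<open>x ^ k = 1\<close>,
  then \<open>x ^ (k - 1)\<close> is the inverse of \<open>x\<close>.\<close>

lemma subfield_range_ev:
  assumes "c \<in> C"
  shows "subfield (range (ev c))"
proof
  show "0 \<in> range (ev c)" "1 \<in> range (ev c)"
    using ev.hom_zero ev.hom_one by (metis rangeI)+
  fix x y assume "x \<in> range (ev c)" "y \<in> range (ev c)"
  then show "x + y \<in> range (ev c)" "x * y \<in> range (ev c)"
    by (auto simp flip: ev.hom_add ev.hom_mult)
next
  fix x assume "x \<in> range (ev c)"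
  then show "- x \<in> range (ev c)" by (auto simp flip: ev.hom_uminus)
next
  fix x assume "x \<in> range (ev c)"
  then obtain h where h: "x = ev c h" by blast
  show "inverse x \<in> range (ev c)"
  proof (cases "x = 0")
    case True
    then show ?thesis using ev.hom_zero by (metis inverse_zero rangeI)
  next
    case False
    then obtain k where "k > 0" "x ^ k = 1" using ev_power_eq_1[OF assms] h by auto
    then have "x * x ^ (k - 1) = 1" by (metis power_eq_if neq0_conv)
    then have "inverse x = ev c (h ^ (k - 1))"
      by (simp add: h ev.hom_power inverse_unique)
    then show ?thesis by simp
  qed
qed

text \<open>Having the same vanishing ideal amounts to being conjugate over the finite base field.\<close>

definition conjugates :: "'b \<Rightarrow> 'b \<Rightarrow> bool" where
  "conjugates c c' \<longleftrightarrow> (\<forall>h. ev c h = 0 \<longleftrightarrow> ev c' h = 0)"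

text \<open>Some \<open>h\<close> vanishes at exactly one of the two points. A suitable power takes
  the value 1 at the other, and \<open>1 - h ^ k\<close> serves when the roles are reversed.\<close>

lemma separating_poly:
  assumes "c \<in> C" "c' \<in> C" "\<not> conjugates c c'"
  shows "\<exists>e. ev c e = 1 \<and> ev c' e = 0"
proof -
  obtain h where "(ev c h = 0) \<noteq> (ev c' h = 0)" using assms(3) by (auto simp: conjugates_def)
  then consider "ev c h = 0" "ev c' h \<noteq> 0" | "ev c h \<noteq> 0" "ev c' h = 0" by blast
  then show ?thesis
  proof cases
    case 1
    then obtain k where "k > 0" "ev c' h ^ k = 1" using ev_power_eq_1[OF assms(2)] by blast
    with 1 show ?thesis by (intro exI[of _ "1 - h ^ k"]) (simp add: ev.hom_minus ev.hom_power)
  next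
    case 2
    then obtain k where "k > 0" "ev c h ^ k = 1" using ev_power_eq_1[OF assms(1)] by blast
    with 2 show ?thesis by (intro exI[of _ "h ^ k"]) (simp add: ev.hom_power)
  qed
qed

text \<open>The product of the separating polynomials over the finitely many points not conjugate to
  \<open>c\<close>.\<close>

lemma conj_idempotent:
  assumes "c \<in> C"
  shows "\<exists>e. ev c e = 1 \<and> (\<forall>c'\<in>C. \<not> conjugates c c' \<longrightarrow> ev c' e = 0)"
proof -
  obtain e where e: "\<And>c'. c' \<in> C \<Longrightarrow> \<not> conjugates c c' \<Longrightarrow> ev c (e c') = 1 \<and> ev c' (e c') = 0"
    using separating_poly[OF assms] by metis
  define T where "T = {c'\<in>C. \<not> conjugates c c'}"
  have fin: "finite T" using finite_C by (simp add: T_def C_def)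
  have "ev c (prod e T) = 1"
    using e by (auto simp: ev.hom_prod T_def intro!: prod.neutral)
  moreover have "ev c' (prod e T) = 0" if "c' \<in> C" "\<not> conjugates c c'" for c'
    unfolding ev.hom_prod using that e fin by (intro prod_zero) (auto simp: T_def)
  ultimately show ?thesis by blast
qed

section \<open>Specialization of polynomials and of maps\<close>

lemma lookup_spec: "Poly_Mapping.lookup (spec \<iota> c p) a = ev c (Poly_Mapping.lookup p a)"
  by (simp add: spec_def map.rep_eq when_def ev_def)

text \<open>Recasts the coefficientwise definition as an evaluation fixing the variables, from which
  the homomorphism laws follow.\<close>

lemma spec_eq_meval: "spec \<iota> c p = meval (\<lambda>h. mConst (ev c h)) mVar p"
proof -
  have "meval (\<lambda>h. mConst (ev c h)) mVar p
      = (\<Sum>a\<in>Poly_Mapping.keys p. Poly_Mapping.single a (ev c (Poly_Mapping.lookup p a)))"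
    by (simp add: meval_def single_eq_mConst_mon)
  then show ?thesis
    by (intro poly_mapping_eqI)
      (simp add: lookup_spec lookup_sum lookup_single when_def in_keys_iff)
qed

lemma mConst_ev_hom: "comm_ring_hom (\<lambda>h. mConst (ev c h))"
  by unfold_locales (simp_all add: ev.hom_add ev.hom_mult mConst.hom_add mConst.hom_mult)

sublocale spec: comm_ring_hom "spec \<iota> c" for c
proof -
  have "spec \<iota> c = meval (\<lambda>h. mConst (ev c h)) mVar"
    by (simp add: fun_eq_iff spec_eq_meval)
  then show "comm_ring_hom (spec \<iota> c)"
    using comm_ring_hom.meval_hom[OF mConst_ev_hom] by metis
qed

lemma spec_mConst [simp]: "spec \<iota> c (mConst h) = mConst (ev c h)"
  unfolding spec_eq_meval by (rule comm_ring_hom.meval_mConst[OF mConst_ev_hom])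

lemma spec_mVar [simp]: "spec \<iota> c (mVar i) = mVar i"
  unfolding spec_eq_meval by (rule comm_ring_hom.meval_mVar[OF mConst_ev_hom])

lemma spec_subst: "spec \<iota> c (Defs.subst p G) = Defs.subst (spec \<iota> c p) (\<lambda>i. spec \<iota> c (G i))"
  by (induction p rule: mpoly_induct)
    (simp_all add: subst.hom_add subst.hom_mult spec.hom_add spec.hom_mult)

lemma evalp_spec: "evalp (spec \<iota> c p) (\<lambda>i. ev c (x i)) = ev c (evalp p x)"
  by (induction p rule: mpoly_induct)
    (simp_all add: spec.hom_add spec.hom_mult evalp.hom_add evalp.hom_mult ev.hom_add ev.hom_mult)

lemma pder_spec: "pder (spec \<iota> c p) (\<lambda>i. ev c (x i)) (\<lambda>i. ev c (v i)) = ev c (pder p x v)"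
  by (induction p rule: mpoly_induct)
    (simp_all add: spec.hom_add spec.hom_mult pder_add pder_mult evalp_spec ev.hom_add ev.hom_mult)

lemma vars_in_spec: "vars_in V p \<Longrightarrow> vars_in V (spec \<iota> c p)"
  by (auto simp: vars_in_def in_keys_iff lookup_spec)

definition specm :: "'b \<Rightarrow> 'a poly pmap \<Rightarrow> 'b pmap" where
  "specm c F = (\<lambda>i. spec \<iota> c (F i))"

lemma specm_pcomp: "specm c (pcomp n F G) = pcomp n (specm c F) (specm c G)"
  by (auto simp: specm_def pcomp_def spec_subst)

lemma specm_pid: "specm c (pid n) = pid n"
  by (auto simp: specm_def pid_def)

lemma specm_dscale: "specm c (dscale n d) = dscale n (ev c d)"
  by (auto simp: specm_def dscale_def spec.hom_mult)

lemma specm_elmap: "specm c (elmap n i f) = elmap n i (spec \<iota> c f)"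
  by (auto simp: specm_def elmap_def spec.hom_add)

lemma specm_pmap: "is_pmap n UNIV F \<Longrightarrow> is_pmap n UNIV (specm c F)"
  by (auto simp: is_pmap_def specm_def vars_in_spec)

text \<open>Differences of corresponding coefficients vanish at \<open>c\<close>, hence at every
  conjugate.\<close>

lemma specm_conj:
  assumes "specm c F = specm c G" "conjugates c c'"
  shows "specm c' F = specm c' G"
proof
  fix i
  have "ev c' (Poly_Mapping.lookup (F i) a) = ev c' (Poly_Mapping.lookup (G i) a)" for a
  proof -
    have "ev c (Poly_Mapping.lookup (F i) a - Poly_Mapping.lookup (G i) a) = 0"
      using assms(1) by (simp add: specm_def fun_eq_iff ev.hom_minus flip: lookup_spec)
    then have "ev c' (Poly_Mapping.lookup (F i) a - Poly_Mapping.lookup (G i) a) = 0"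
      using assms(2) by (simp add: conjugates_def)
    then show ?thesis by (simp add: ev.hom_minus)
  qed
  then show "specm c' F i = specm c' G i"
    by (auto simp: specm_def lookup_spec intro!: poly_mapping_eqI)
qed

text \<open>The origin specializes to the origin, and determinants commute with ring
  homomorphisms.\<close>

lemma det_jac_specm: "det (jac n (specm c F) (\<lambda>_. 0)) = ev c (det (jac n F (\<lambda>_. 0)))"
proof -
  have "pder (spec \<iota> c p) (\<lambda>_. 0) (unitv j) = ev c (pder p (\<lambda>_. 0) (unitv j))" for p j
  proof -
    have "(\<lambda>i. ev c (unitv j i)) = unitv j" by (auto simp: unitv_def)
    then show ?thesis using pder_spec[of c p "\<lambda>_. 0" "unitv j"] by simp
  qed
  then have "jac n (specm c F) (\<lambda>_. 0) = map_mat (ev c) (jac n F (\<lambda>_. 0))"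
    by (intro eq_matI) (auto simp: jac_def specm_def)
  then show ?thesis by simp
qed

text \<open>Preimages are chosen coefficient by coefficient on the support of \<open>f\<close> only.
  Coefficients that are zero remain zero, so no new variables appear.\<close>

lemma spec_lift:
  assumes "coeffs_in (range (ev c)) f"
  shows "\<exists>g. spec \<iota> c g = f \<and> (\<forall>V. vars_in V f \<longrightarrow> vars_in V g)"
proof -
  define r where "r = (\<lambda>s. SOME h. ev c h = s)"
  have r: "ev c (r s) = s" if "s \<in> range (ev c)" for s
    unfolding r_def using that by (metis (mono_tags) rangeE someI)
  define g where "g = Poly_Mapping.map r f"
  have g: "Poly_Mapping.lookup g a = (if a \<in> Poly_Mapping.keys f then r (Poly_Mapping.lookup f a) else 0)" for a
    by (simp add: g_def map.rep_eq when_def in_keys_iff)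
  have "spec \<iota> c g = f"
    using assms by (intro poly_mapping_eqI) (auto simp: lookup_spec g r coeffs_in_def in_keys_iff)
  moreover have "Poly_Mapping.keys g \<subseteq> Poly_Mapping.keys f"
    using g by (metis in_keys_iff subsetI)
  then have "\<forall>V. vars_in V f \<longrightarrow> vars_in V g" by (auto simp: vars_in_def)
  ultimately show ?thesis by blast
qed

text \<open>A lift is multiplied by the polynomial from \<open>conj_idempotent\<close>, which has
  value 1 at \<open>c\<close> and 0 at the points not conjugate to it.\<close>

lemma elem_poly_lift:
  assumes "c \<in> C" "elem_poly n (range (ev c)) i f"
  shows "\<exists>g. elem_poly n UNIV i g \<and> spec \<iota> c g = f \<and> (\<forall>c'\<in>C. \<not> conjugates c c' \<longrightarrow> spec \<iota> c' g = 0)"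
proof -
  obtain e where e: "ev c e = 1" "\<And>c'. c' \<in> C \<Longrightarrow> \<not> conjugates c c' \<Longrightarrow> ev c' e = 0"
    using conj_idempotent[OF assms(1)] by blast
  have "\<exists>g. elem_poly n UNIV i g \<and> spec \<iota> c g = f"
  proof (cases "vars_in {i<..<n} f")
    case True
    then show ?thesis
      using spec_lift[of c f] assms(2) by (auto simp: elem_poly_def)
  next
    case False
    then obtain h j where "j < i" "f = mConst (ev c h) * mVar j" "i < n"
      using assms(2) by (auto simp: elem_poly_def)
    \<comment> \<open>Only the scalar is lifted, so that the lift is visibly again a constant times
      a variable.\<close>
    then show ?thesis
      by (intro exI[of _ "mConst h * mVar j"]) (auto simp: elem_poly_def spec.hom_mult)
  qed
  then obtain g where g: "elem_poly n UNIV i g" "spec \<iota> c g = f" by blast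
  have "elem_poly n UNIV i (mConst e * g)"
  proof -
    have "mConst e * (mConst a * mVar j) = mConst (e * a) * mVar j" for a j
      by (simp add: mConst.hom_mult mult.assoc)
    then show ?thesis
      using g(1) unfolding elem_poly_def by (metis UNIV_I coeffs_in_UNIV vars_in_mConst vars_in_mult)
  qed
  then show ?thesis
    using e g(2) by (intro exI[of _ "mConst e * g"]) (auto simp: spec.hom_mult)
qed

text \<open>The factors are lifted one by one. Away from the conjugates of \<open>c\<close> each
  lifted polynomial specializes to 0 and its elementary map to the identity.\<close>

lemma EA_lift:
  assumes "c \<in> C" "E \<in> EA n (range (ev c))"
  shows "\<exists>G\<in>EA n UNIV. specm c G = E \<and> (\<forall>c'\<in>C. \<not> conjugates c c' \<longrightarrow> specm c' G = pid n)"
  using assms(2)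
proof induction
  case EA_pid
  show ?case using EA.EA_pid specm_pid by blast
next
  case (EA_step i f E)
  obtain G where G: "G \<in> EA n UNIV" "specm c G = E" "\<forall>c'\<in>C. \<not> conjugates c c' \<longrightarrow> specm c' G = pid n"
    using EA_step by blast
  obtain g where g: "elem_poly n UNIV i g" "spec \<iota> c g = f" "\<forall>c'\<in>C. \<not> conjugates c c' \<longrightarrow> spec \<iota> c' g = 0"
    using elem_poly_lift[OF assms(1) EA_step(1)] by blast
  have "elmap n i 0 = (pid n :: 'b pmap)" by (auto simp: elmap_def pid_def)
  then have "\<forall>c'\<in>C. \<not> conjugates c c' \<longrightarrow> specm c' (pcomp n (elmap n i g) G) = pid n"
    using G(3) g(3) by (simp add: specm_pcomp specm_elmap pcomp_pid_left[OF subring.pid_pmap[OF subring_UNIV]])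
  moreover have "specm c (pcomp n (elmap n i g) G) = pcomp n (elmap n i f) E"
    by (simp add: specm_pcomp specm_elmap G g)
  ultimately show ?case using EA.EA_step[OF g(1) G(1)] by blast
qed

text \<open>Points are added to \<open>T\<close> one at a time. Each lift acts on a single conjugacy
  class and is the identity at the rest of \<open>C\<close>, so the composed lifts do not disturb
  each other.\<close>

lemma EA_interpolate:
  assumes F: "\<And>c. c \<in> C \<Longrightarrow> specm c F \<in> EA n (range (ev c))"
  shows "\<exists>G\<in>EA n UNIV. \<forall>c\<in>C. specm c G = specm c F"
proof -
  interpret UNIV: subring "UNIV :: 'a poly set" by (rule subring_UNIV)
  have "\<exists>G\<in>EA n UNIV. \<forall>c'\<in>C. specm c' G = (if \<exists>c\<in>T. conjugates c c' then specm c' F else pid n)"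
    if "finite T" "T \<subseteq> C" for T
    using that
  proof (induction T)
    case empty
    show ?case using EA_pid[of n UNIV] specm_pid by force
  next
    case (insert c T)
    then obtain G where G: "G \<in> EA n UNIV"
      "\<And>c'. c' \<in> C \<Longrightarrow> specm c' G = (if \<exists>c\<in>T. conjugates c c' then specm c' F else pid n)" by auto
    show ?case
    proof (cases "\<exists>d\<in>T. conjugates d c")
      case True
      \<comment> \<open>The class of \<open>c\<close> is treated already; a second lift would apply
        \<open>F\<close> twice there.\<close>
      then have "(\<exists>d\<in>insert c T. conjugates d c') \<longleftrightarrow> (\<exists>d\<in>T. conjugates d c')" for c'
        by (auto simp: conjugates_def)
      then show ?thesis using G by (intro bexI[of _ G]) simp_all
    next
      case False
      have c: "c \<in> C" using insert by simp
      obtain H where H: "H \<in> EA n UNIV" "specm c H = specm c F"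
        "\<And>c'. c' \<in> C \<Longrightarrow> \<not> conjugates c c' \<Longrightarrow> specm c' H = pid n"
        using EA_lift[OF c F[OF c]] by blast
      have pm: "is_pmap n UNIV (specm c' G)" "is_pmap n UNIV (specm c' H)" for c'
        by (intro specm_pmap UNIV.EA_pmap G H)+
      have "specm c' (pcomp n G H) = (if \<exists>d\<in>insert c T. conjugates d c' then specm c' F else pid n)"
        if c': "c' \<in> C" for c'
      proof (cases "conjugates c c'")
        case True
        then have "\<not> (\<exists>d\<in>T. conjugates d c')" using False by (auto simp: conjugates_def)
        then have "specm c' (pcomp n G H) = specm c' H"
          by (simp add: specm_pcomp G(2)[OF c'] pcomp_pid_left[OF pm(2)])
        then show ?thesis using specm_conj[OF H(2) True] True by simp
      next
        case False
        then have "specm c' (pcomp n G H) = specm c' G"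
          by (simp add: specm_pcomp H(3)[OF c'] pcomp_pid_right[OF pm(1)])
        then show ?thesis using G(2)[OF c'] False by simp
      qed
      then show ?thesis using UNIV.EA_comp[OF G(1) H(1)] by blast
    qed
  qed
  from this[of C] obtain G where G: "G \<in> EA n UNIV"
    "\<forall>c'\<in>C. specm c' G = (if \<exists>c\<in>C. conjugates c c' then specm c' F else pid n)"
    using finite_C by (auto simp: C_def)
  moreover have "\<exists>d\<in>C. conjugates d c" if "c \<in> C" for c
    using that by (auto simp: conjugates_def)
  ultimately show ?thesis by (intro bexI[of _ G]) simp_all
qed

text \<open>The Jacobian determinant is divided out of \<open>F\<close>, the elementary
  specializations that result are interpolated, and the determinant is put back as a diagonal
  factor.\<close>

lemma TA_interpolate:
  assumes F: "F \<in> GA n UNIV" and tame: "\<And>c. c \<in> C \<Longrightarrow> specm c F \<in> TA n (range (ev c))"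
  shows "\<exists>G\<in>TA n UNIV. \<forall>c\<in>C. specm c G = specm c F"
proof -
  interpret UNIV: subring "UNIV :: 'a poly set" by (rule subring_UNIV)
  have pm: "is_pmap n UNIV F" using F by (simp add: GA_def)
  show ?thesis
  \<comment> \<open>For \<open>n = 0\<close> there is no coordinate to carry the scalar, and the
    empty determinant is always 1.\<close>
  proof (cases "n = 0")
    case True
    then have "F = pid n" using pm by (auto simp: is_pmap_def pid_def)
    then show ?thesis using UNIV.EA_TA[OF EA_pid] by blast
  next
    case False
    \<comment> \<open>The units of a polynomial ring over a field are the nonzero constants.\<close>
    obtain \<delta> where \<delta>: "\<delta> \<noteq> 0" "det (jac n F (\<lambda>_. 0)) = [:\<delta>:]"
      using det_jac_GA_unit[OF F, of "\<lambda>_. 0"] unfolding is_unit_poly_iff by fastforce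
    have inv: "\<iota> (inverse \<delta>) * \<iota> \<delta> = 1"
      using \<delta>(1) by (simp flip: \<iota>.hom_mult)
    define F' where "F' = pcomp n (dscale n [:inverse \<delta>:]) F"
    have "specm c F' \<in> EA n (range (ev c))" if c: "c \<in> C" for c
    proof -
      interpret S: subfield "range (ev c)" by (rule subfield_range_ev[OF c])
      obtain d E where dE: "d \<in> range (ev c)" "E \<in> EA n (range (ev c))" "specm c F = pcomp n (dscale n d) E"
        using S.TA_NF[OF tame[OF c]] by (auto simp: S.NF_def)
      have "\<iota> \<delta> = det (jac n (specm c F) (\<lambda>_. 0))"
        by (simp add: det_jac_specm \<delta>(2))
      \<comment> \<open>The scalar of the normal form is the image of \<open>\<delta>\<close>, the
        same for every \<open>c\<close>, so one factor over the base field removes it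
        everywhere.\<close>
      also have "\<dots> = d"
        using False by (simp add: dE(3) det_jac_pcomp[OF S.EA_pmap[OF dE(2)]] det_jac_dscale S.det_jac_EA[OF dE(2)])
      finally have "specm c F' = pcomp n (dscale n (\<iota> (inverse \<delta>) * \<iota> \<delta>)) E"
        by (simp add: F'_def specm_pcomp specm_dscale dE(3) flip: dscale_mult pcomp_assoc[OF S.dscale_pmap[OF dE(1)]])
      then show ?thesis
        using dE(2) by (simp add: inv dscale_1 pcomp_pid_left[OF S.EA_pmap])
    qed
    then obtain G where G: "G \<in> EA n UNIV" "\<And>c. c \<in> C \<Longrightarrow> specm c G = specm c F'"
      using EA_interpolate by blast
    have "unit_in UNIV [:\<delta>:]"
      using \<delta>(1) by (auto simp: unit_in_def one_pCons intro!: exI[of _ "[:inverse \<delta>:]"])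
    then have "pcomp n (dscale n [:\<delta>:]) G \<in> TA n UNIV"
      by (intro TA.comp UNIV.dscale_TA UNIV.EA_TA G)
    moreover have "pcomp n (dscale n [:\<delta>:]) F' = F"
    proof -
      have "pcomp n (dscale n [:\<delta>:]) F' = pcomp n (dscale n ([:\<delta>:] * [:inverse \<delta>:])) F"
        by (simp add: F'_def pcomp_assoc[OF UNIV.dscale_pmap[OF UNIV_I], symmetric] dscale_mult)
      also have "[:\<delta>:] * [:inverse \<delta>:] = 1" using \<delta>(1) by (simp add: one_pCons)
      finally show ?thesis by (simp add: dscale_1 pcomp_pid_left[OF pm])
    qed
    then have "specm c (pcomp n (dscale n [:\<delta>:]) G) = specm c F" if "c \<in> C" for c
      using G(2)[OF that] by (metis specm_pcomp)
    ultimately show ?thesis by blast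
  qed
qed

end

theorem mainTheorem1:
  fixes n :: nat and q :: nat
    and \<iota> :: "'a::{finite,field} \<Rightarrow> 'b::field"
    and F :: "'a poly pmap"
  assumes q_def: "q = card (UNIV :: 'a set)"
    and hom: "ring_hom_fun \<iota>"
    and ext: "\<forall>m\<ge>1. card {x::'b. x ^ (q ^ m) = x} = q ^ m"
    and GA: "F \<in> GA n UNIV"
    and TA_frac: "(\<lambda>i. to_frac (F i)) \<in> TA n UNIV"
    and TA_spec: "\<forall>m\<ge>1. \<forall>c::'b. c ^ (q ^ m) = c \<longrightarrow>
                    (\<lambda>i. spec \<iota> c (F i)) \<in> TA n (range (\<lambda>h. poly (map_poly \<iota> h) c))"
  shows "\<forall>m\<ge>1. \<exists>G. G \<in> TA n (UNIV :: 'a poly set) \<and>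
           (\<forall>c::'b. \<forall>x::nat \<Rightarrow> 'b. c ^ (q ^ m) = c \<longrightarrow> (\<forall>j<n. x j ^ (q ^ m) = x j) \<longrightarrow>
              (\<forall>i<n. evalp (spec \<iota> c (G i)) x = evalp (spec \<iota> c (F i)) x))"
proof (intro allI impI)
  fix m :: nat assume m: "m \<ge> 1"
  have "card {0, 1 :: 'a} \<le> q" unfolding q_def by (intro card_mono) auto
  then have q: "q \<ge> 2" by simp
  have N: "q ^ m \<ge> 2" using q m self_le_power[of q m] by linarith
  \<comment> \<open>Infinite sets have \<open>card\<close> 0, so a positive cardinality yields
    finiteness.\<close>
  have "card {x::'b. x ^ (q ^ m) = x} > 0" using ext m N by (metis less_le_trans zero_less_numeral)
  then have fin: "finite {x::'b. x ^ (q ^ m) = x}" by (rule card_ge_0_finite)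
  interpret specialization \<iota> "q ^ m"
    using hom N fin by unfold_locales
  have "specm c F \<in> TA n (range (ev c))" if "c \<in> C" for c
    using TA_spec m that unfolding C_def specm_def ev_def[abs_def] by blast
  from TA_interpolate[OF GA this] obtain G where G: "G \<in> TA n UNIV" "\<forall>c\<in>C. specm c G = specm c F"
    by blast
  \<comment> \<open>Equality of the specialized polynomials gives equality of values at every point
    \<open>x\<close>.\<close>
  have "spec \<iota> c (G i) = spec \<iota> c (F i)" if "c ^ (q ^ m) = c" for c i
  proof -
    have "specm c G = specm c F" using G(2) that by (simp add: C_def)
    then show ?thesis unfolding specm_def by (rule fun_cong)
  qed
  then show "\<exists>G. G \<in> TA n (UNIV :: 'a poly set) \<and>
           (\<forall>c::'b. \<forall>x::nat \<Rightarrow> 'b. c ^ (q ^ m) = c \<longrightarrow> (\<forall>j<n. x j ^ (q ^ m) = x j) \<longrightarrow>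
              (\<forall>i<n. evalp (spec \<iota> c (G i)) x = evalp (spec \<iota> c (F i)) x))"
    using G(1) by auto
qed

end
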